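(* Let $\mathcal{A}$ be any abelian category and let $\mathcal{F}_1\subset\mathcal{F}_2\subset\mathcal{G}$ be a filtration of an object $\mathcal{G}$ of $\mathcal{A}$ by subobjects, yielding the exact sequence $$0\longrightarrow \mathcal{F}_1\longrightarrow \mathcal{F}_2\stackrel{f}{\longrightarrow}\mathcal{G}/\mathcal{F}_1\longrightarrow \mathcal{G}/\mathcal{F}_2\longrightarrow 0,$$ where $f$ is the composition of the embedding $\mathcal{F}_2\to\mathcal{G}$ with the canonical surjection $\mathcal{G}\to\mathcal{G}/\mathcal{F}_1$. Let $\alpha\in \mathrm{Ext}^2_{\mathcal{A}}(\mathcal{G}/\mathcal{F}_2,\mathcal{F}_1)\simeq \mathrm{Hom}_{D(\mathcal{A})}(\mathcal{G}/\mathcal{F}_2,\mathcal{F}_1[2])$ be the class corresponding to this exact sequence. Then there exist $$\alpha_1\in \mathrm{Ext}^1_{\mathcal{A}}(\mathcal{F}_2/\mathcal{F}_1,\mathcal{F}_1)\simeq \mathrm{Hom}_{D(\mathcal{A})}(\mathcal{F}_2/\mathcal{F}_1,\mathcal{F}_1[1]),$$ $$\alpha_2\in \mathrm{Ext}^1_{\mathcal{A}}(\mathcal{G}/\mathcal{F}_2,\mathcal{F}_2/\mathcal{F}_1)\simeq \mathrm{Hom}_{D(\mathcal{A})}(\mathcal{G}/\mathcal{F}_2,(\mathcal{F}_2/\mathcal{F}_1)[1]),$$ corresponding respectively to the short exact sequences $$0\to\mathcal{F}_1\to\mathcal{F}_2\to\mathcal{F}_2/\mathcal{F}_1\to 0\quad\text{and}\quad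 0\to\mathcal{F}_2/\mathcal{F}_1\to\mathcal{G}/\mathcal{F}_1\to\mathcal{G}/\mathcal{F}_2\to 0,$$ such that $\alpha=\alpha_1\cdot\alpha_2$.
   Context: $D(\mathcal{A})$ is the derived category of $\mathcal{A}$ (the localization of the homotopy category of cochain complexes at quasi-isomorphisms), $[i]$ is the $i$-fold shift, and $\mathcal{A}$ is regarded as the full subcategory of $D(\mathcal{A})$ of complexes concentrated in degree $0$. One identifies $\mathrm{Ext}^i_{\mathcal{A}}(A,B)$ with $\mathrm{Hom}_{D(\mathcal{A})}(A,B[i])$. Class of an exact sequence (Yoneda's construction): the exact sequence $0\to B\to E_i\to\cdots\to E_1\to C\to 0$ in $\mathcal{A}$ corresponds to the morphism $C\to B[i]$ in $D(\mathcal{A})$ represented by the roof $C\stackrel{s}{\longleftarrow}\tilde{\mathcal{L}}^\bullet\stackrel{g}{\longrightarrow}B[i]$. Here $\tilde{\mathcal{L}}^\bullet$ is the complex $B\to E_i\to\cdots\to E_1$ with $E_1$ in degree $0$ and $B$ in degree $-i$. The map $s$ is the quasi-isomorphism given by $E_1\to C$ in degree $0$ and zero in other degrees. The map $g$ is the identity of $B$ in degree $-i$ and zero in other degrees. Yoneda product: for $\alpha_2\in \mathrm{Hom}_{D(\mathcal{A})}(A,B[1])$ and $\alpha_1\in\mathrm{Hom}_{D(\mathcal{A})}(B,C[1])$, the product $\alpha_1\cdot\alpha_2$ is the composition $\alpha_1[1]\circ\alpha_2\in\mathrm{Hom}_{D(\mathcal{A})}(A,C[2])$. *)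

theory Defs
  imports "HOL-Algebra.Group"
begin

record ('o, 'm) cat =
  Obj :: "'o set"
  Arr :: "'m set"
  Src :: "'m \<Rightarrow> 'o"
  Tgt :: "'m \<Rightarrow> 'o"
  Idt :: "'o \<Rightarrow> 'm"
  Cmp :: "'m \<Rightarrow> 'm \<Rightarrow> 'm"  (infixr "\<odot>\<index>" 70)

definition Hom :: "('o, 'm, 'x) cat_scheme \<Rightarrow> 'o \<Rightarrow> 'o \<Rightarrow> 'm set" where
  "Hom C A B = {f \<in> Arr C. Src C f = A \<and> Tgt C f = B}"

locale category =
  fixes C :: "('o, 'm, 'x) cat_scheme" (structure)
  assumes src_obj: "f \<in> Arr C \<Longrightarrow> Src C f \<in> Obj C"
    and tgt_obj: "f \<in> Arr C \<Longrightarrow> Tgt C f \<in> Obj C"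
    and idt_hom: "A \<in> Obj C \<Longrightarrow> Idt C A \<in> Hom C A A"
    and cmp_hom: "\<lbrakk>f \<in> Hom C A B; g \<in> Hom C B D\<rbrakk> \<Longrightarrow> g \<odot> f \<in> Hom C A D"
    and cmp_idt_right: "f \<in> Hom C A B \<Longrightarrow> f \<odot> Idt C A = f"
    and cmp_idt_left: "f \<in> Hom C A B \<Longrightarrow> Idt C B \<odot> f = f"
    and cmp_assoc: "\<lbrakk>f \<in> Hom C A B; g \<in> Hom C B D; h \<in> Hom C D E\<rbrakk>
                     \<Longrightarrow> (h \<odot> g) \<odot> f = h \<odot> (g \<odot> f)"

definition monic :: "('o, 'm, 'x) cat_scheme \<Rightarrow> 'm \<Rightarrow> bool" where
  "monic C f \<longleftrightarrow> f \<in> Arr C \<and>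
     (\<forall>A. \<forall>g \<in> Hom C A (Src C f). \<forall>h \<in> Hom C A (Src C f). f \<odot>\<^bsub>C\<^esub> g = f \<odot>\<^bsub>C\<^esub> h \<longrightarrow> g = h)"

definition epic :: "('o, 'm, 'x) cat_scheme \<Rightarrow> 'm \<Rightarrow> bool" where
  "epic C f \<longleftrightarrow> f \<in> Arr C \<and>
     (\<forall>A. \<forall>g \<in> Hom C (Tgt C f) A. \<forall>h \<in> Hom C (Tgt C f) A. g \<odot>\<^bsub>C\<^esub> f = h \<odot>\<^bsub>C\<^esub> f \<longrightarrow> g = h)"

definition isomorphism :: "('o, 'm, 'x) cat_scheme \<Rightarrow> 'm \<Rightarrow> bool" where
  "isomorphism C f \<longleftrightarrow> f \<in> Arr C \<and>
     (\<exists>g \<in> Hom C (Tgt C f) (Src C f).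
        g \<odot>\<^bsub>C\<^esub> f = Idt C (Src C f) \<and> f \<odot>\<^bsub>C\<^esub> g = Idt C (Tgt C f))"

record ('o, 'm) precat = "('o, 'm) cat" +
  Add :: "'m \<Rightarrow> 'm \<Rightarrow> 'm"
  Zero :: "'o \<Rightarrow> 'o \<Rightarrow> 'm"

definition hom_group :: "('o, 'm, 'x) precat_scheme \<Rightarrow> 'o \<Rightarrow> 'o \<Rightarrow> 'm monoid" where
  "hom_group C A B = \<lparr>carrier = Hom C A B, monoid.mult = Add C, one = Zero C A B\<rparr>"

locale preadditive_category = category C
  for C :: "('o, 'm, 'x) precat_scheme" (structure) +
  assumes hom_comm_group: "\<lbrakk>A \<in> Obj C; B \<in> Obj C\<rbrakk> \<Longrightarrow> comm_group (hom_group C A B)"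
    and cmp_add_right: "\<lbrakk>f \<in> Hom C A B; g \<in> Hom C A B; h \<in> Hom C B D\<rbrakk>
                         \<Longrightarrow> h \<odot> Add C f g = Add C (h \<odot> f) (h \<odot> g)"
    and cmp_add_left: "\<lbrakk>f \<in> Hom C A B; g \<in> Hom C B D; h \<in> Hom C B D\<rbrakk>
                         \<Longrightarrow> Add C g h \<odot> f = Add C (g \<odot> f) (h \<odot> f)"

definition is_zero_obj :: "('o, 'm, 'x) precat_scheme \<Rightarrow> 'o \<Rightarrow> bool" where
  "is_zero_obj C Z \<longleftrightarrow> Z \<in> Obj C \<and>
     (\<forall>A \<in> Obj C. (\<exists>!f. f \<in> Hom C A Z) \<and> (\<exists>!f. f \<in> Hom C Z A))"

definition zero_obj :: "('o, 'm, 'x) precat_scheme \<Rightarrow> 'o" where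
  "zero_obj C = (SOME Z. is_zero_obj C Z)"

definition is_biproduct ::
  "('o, 'm, 'x) precat_scheme \<Rightarrow> 'o \<Rightarrow> 'o \<Rightarrow> 'o \<Rightarrow> 'm \<Rightarrow> 'm \<Rightarrow> 'm \<Rightarrow> 'm \<Rightarrow> bool" where
  "is_biproduct C A B P i j p q \<longleftrightarrow>
     i \<in> Hom C A P \<and> j \<in> Hom C B P \<and> p \<in> Hom C P A \<and> q \<in> Hom C P B \<and>
     p \<odot>\<^bsub>C\<^esub> i = Idt C A \<and> q \<odot>\<^bsub>C\<^esub> j = Idt C B \<and>
     q \<odot>\<^bsub>C\<^esub> i = Zero C A B \<and> p \<odot>\<^bsub>C\<^esub> j = Zero C B A \<and>
     Add C (i \<odot>\<^bsub>C\<^esub> p) (j \<odot>\<^bsub>C\<^esub> q) = Idt C P"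

definition is_kernel :: "('o, 'm, 'x) precat_scheme \<Rightarrow> 'm \<Rightarrow> 'm \<Rightarrow> bool" where
  "is_kernel C k f \<longleftrightarrow> k \<in> Arr C \<and> f \<in> Arr C \<and> Tgt C k = Src C f \<and>
     f \<odot>\<^bsub>C\<^esub> k = Zero C (Src C k) (Tgt C f) \<and>
     (\<forall>g \<in> Arr C. Tgt C g = Src C f \<and> f \<odot>\<^bsub>C\<^esub> g = Zero C (Src C g) (Tgt C f) \<longrightarrow>
        (\<exists>!z. z \<in> Hom C (Src C g) (Src C k) \<and> k \<odot>\<^bsub>C\<^esub> z = g))"

definition is_cokernel :: "('o, 'm, 'x) precat_scheme \<Rightarrow> 'm \<Rightarrow> 'm \<Rightarrow> bool" where
  "is_cokernel C c f \<longleftrightarrow> c \<in> Arr C \<and> f \<in> Arr C \<and> Src C c = Tgt C f \<and>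
     c \<odot>\<^bsub>C\<^esub> f = Zero C (Src C f) (Tgt C c) \<and>
     (\<forall>g \<in> Arr C. Src C g = Tgt C f \<and> g \<odot>\<^bsub>C\<^esub> f = Zero C (Src C f) (Tgt C g) \<longrightarrow>
        (\<exists>!u. u \<in> Hom C (Tgt C c) (Tgt C g) \<and> u \<odot>\<^bsub>C\<^esub> c = g))"

locale abelian_category = preadditive_category C
  for C :: "('o, 'm, 'x) precat_scheme" (structure) +
  assumes ex_zero_obj: "\<exists>Z. is_zero_obj C Z"
    and ex_biproduct: "\<lbrakk>A \<in> Obj C; B \<in> Obj C\<rbrakk> \<Longrightarrow> \<exists>P i j p q. is_biproduct C A B P i j p q"
    and ex_kernel: "f \<in> Arr C \<Longrightarrow> \<exists>k. is_kernel C k f"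
    and ex_cokernel: "f \<in> Arr C \<Longrightarrow> \<exists>c. is_cokernel C c f"
    and monic_normal: "monic C f \<Longrightarrow> \<exists>g. is_kernel C f g"
    and epic_normal: "epic C f \<Longrightarrow> \<exists>g. is_cokernel C f g"

definition ker :: "('o, 'm, 'x) precat_scheme \<Rightarrow> 'm \<Rightarrow> 'm" where
  "ker C f = (SOME k. is_kernel C k f)"

definition coker :: "('o, 'm, 'x) precat_scheme \<Rightarrow> 'm \<Rightarrow> 'm" where
  "coker C f = (SOME c. is_cokernel C c f)"

definition lift :: "('o, 'm, 'x) cat_scheme \<Rightarrow> 'm \<Rightarrow> 'm \<Rightarrow> 'm" where
  "lift C k g = (THE z. z \<in> Hom C (Src C g) (Src C k) \<and> k \<odot>\<^bsub>C\<^esub> z = g)"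

definition colift :: "('o, 'm, 'x) cat_scheme \<Rightarrow> 'm \<Rightarrow> 'm \<Rightarrow> 'm" where
  "colift C c g = (THE u. u \<in> Hom C (Tgt C c) (Tgt C g) \<and> u \<odot>\<^bsub>C\<^esub> c = g)"

text \<open>The image of \<open>f\<close> is the kernel of a cokernel of \<open>f\<close>; exactness says that it is also
  a kernel of \<open>g\<close>.\<close>

definition exact_at :: "('o, 'm, 'x) precat_scheme \<Rightarrow> 'm \<Rightarrow> 'm \<Rightarrow> bool" where
  "exact_at C f g \<longleftrightarrow> f \<in> Arr C \<and> g \<in> Arr C \<and> Tgt C f = Src C g \<and>
     (\<exists>c k. is_cokernel C c f \<and> is_kernel C k c \<and> is_kernel C k g)"

text \<open>The list \<open>[f\<^sub>0, \<dots>, f\<^sub>n]\<close> stands for the sequence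
  \<open>0 \<rightarrow> \<bullet> \<rightarrow> \<dots> \<rightarrow> \<bullet> \<rightarrow> 0\<close> with the maps \<open>f\<^sub>0, \<dots>, f\<^sub>n\<close> between the two end zeros.\<close>

definition exact_sequence :: "('o, 'm, 'x) precat_scheme \<Rightarrow> 'm list \<Rightarrow> bool" where
  "exact_sequence C fs \<longleftrightarrow> fs \<noteq> [] \<and>
     (let gs = Zero C (zero_obj C) (Src C (hd fs)) # fs @ [Zero C (Tgt C (last fs)) (zero_obj C)]
      in \<forall>k. Suc k < length gs \<longrightarrow> exact_at C (gs ! k) (gs ! Suc k))"

record ('o, 'm) cx =
  ob :: "int \<Rightarrow> 'o"
  df :: "int \<Rightarrow> 'm"

definition complexes :: "('o, 'm, 'x) precat_scheme \<Rightarrow> ('o, 'm) cx set" where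
  "complexes C = {X. \<forall>n. ob X n \<in> Obj C \<and> df X n \<in> Hom C (ob X n) (ob X (n + 1)) \<and>
                         df X (n + 1) \<odot>\<^bsub>C\<^esub> df X n = Zero C (ob X n) (ob X (n + 2))}"

definition chain_maps ::
  "('o, 'm, 'x) precat_scheme \<Rightarrow> ('o, 'm) cx \<Rightarrow> ('o, 'm) cx \<Rightarrow> (int \<Rightarrow> 'm) set" where
  "chain_maps C X Y = {f. \<forall>n. f n \<in> Hom C (ob X n) (ob Y n) \<and>
                              df Y n \<odot>\<^bsub>C\<^esub> f n = f (n + 1) \<odot>\<^bsub>C\<^esub> df X n}"

definition homotopic ::
  "('o, 'm, 'x) precat_scheme \<Rightarrow> ('o, 'm) cx \<Rightarrow> ('o, 'm) cx \<Rightarrow> ((int \<Rightarrow> 'm) \<times> (int \<Rightarrow> 'm)) set"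
where
  "homotopic C X Y = {(f, g). f \<in> chain_maps C X Y \<and> g \<in> chain_maps C X Y \<and>
     (\<exists>h. \<forall>n. h n \<in> Hom C (ob X n) (ob Y (n - 1)) \<and>
        f n = Add C (g n) (Add C (df Y (n - 1) \<odot>\<^bsub>C\<^esub> h n) (h (n + 1) \<odot>\<^bsub>C\<^esub> df X n)))}"

type_synonym ('o, 'm) karr = "('o, 'm) cx \<times> (int \<Rightarrow> 'm) set \<times> ('o, 'm) cx"

definition homotopy_class ::
  "('o, 'm, 'x) precat_scheme \<Rightarrow> ('o, 'm) cx \<Rightarrow> ('o, 'm) cx \<Rightarrow> (int \<Rightarrow> 'm) \<Rightarrow> ('o, 'm) karr"
where
  "homotopy_class C X Y f = (X, homotopic C X Y `` {f}, Y)"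

definition homotopy_cat ::
  "('o, 'm, 'x) precat_scheme \<Rightarrow> (('o, 'm) cx, ('o, 'm) karr) cat" where
  "homotopy_cat C = \<lparr>
     Obj = complexes C,
     Arr = {homotopy_class C X Y f | X Y f.
              X \<in> complexes C \<and> Y \<in> complexes C \<and> f \<in> chain_maps C X Y},
     Src = (\<lambda>(X, _, _). X),
     Tgt = (\<lambda>(_, _, Y). Y),
     Idt = (\<lambda>X. homotopy_class C X X (\<lambda>n. Idt C (ob X n))),
     Cmp = (\<lambda>(_, G, Z) (X, F, _).
              (X, homotopic C X Z `` {\<lambda>n. g n \<odot>\<^bsub>C\<^esub> f n | f g. f \<in> F \<and> g \<in> G}, Z))\<rparr>"

text \<open>\<open>coh_proj C X n\<close> is the projection of the cocycles \<open>Src (ker d\<^sup>n)\<close> onto the cohomology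
  object \<open>H\<^sup>n(X) = Tgt (coh_proj C X n)\<close>.\<close>

definition coh_proj :: "('o, 'm, 'x) precat_scheme \<Rightarrow> ('o, 'm) cx \<Rightarrow> int \<Rightarrow> 'm" where
  "coh_proj C X n = coker C (lift C (ker C (df X n)) (df X (n - 1)))"

definition coh_map ::
  "('o, 'm, 'x) precat_scheme \<Rightarrow> ('o, 'm) cx \<Rightarrow> ('o, 'm) cx \<Rightarrow> (int \<Rightarrow> 'm) \<Rightarrow> int \<Rightarrow> 'm" where
  "coh_map C X Y f n =
     colift C (coh_proj C X n)
       (coh_proj C Y n \<odot>\<^bsub>C\<^esub> lift C (ker C (df Y n)) (f n \<odot>\<^bsub>C\<^esub> ker C (df X n)))"

definition quasi_isos :: "('o, 'm, 'x) precat_scheme \<Rightarrow> ('o, 'm) karr set" where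
  "quasi_isos C = {homotopy_class C X Y f | X Y f.
     X \<in> complexes C \<and> Y \<in> complexes C \<and> f \<in> chain_maps C X Y \<and>
     (\<forall>n. isomorphism C (coh_map C X Y f n))}"

text \<open>Gabriel and Zisman's construction: arrows of \<open>K[S\<inverse>]\<close> are zigzags, composed by
  concatenation, modulo the congruence generated by the composition of \<open>K\<close> and by
  making \<open>Bwd s\<close> a two-sided inverse of \<open>Fwd s\<close> for \<open>s \<in> S\<close>. The first letter of a zigzag is
  the one applied first.\<close>

datatype 'm letter = Fwd 'm | Bwd 'm

inductive zigzag ::
  "('o, 'm, 'x) cat_scheme \<Rightarrow> 'm set \<Rightarrow> 'o \<Rightarrow> 'm letter list \<Rightarrow> 'o \<Rightarrow> bool" for K S
where
  zigzag_Nil: "X \<in> Obj K \<Longrightarrow> zigzag K S X [] X"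
| zigzag_Fwd: "\<lbrakk>f \<in> Hom K X Y; zigzag K S Y w Z\<rbrakk> \<Longrightarrow> zigzag K S X (Fwd f # w) Z"
| zigzag_Bwd: "\<lbrakk>s \<in> S; s \<in> Hom K Y X; zigzag K S Y w Z\<rbrakk> \<Longrightarrow> zigzag K S X (Bwd s # w) Z"

inductive zigzag_rule ::
  "('o, 'm, 'x) cat_scheme \<Rightarrow> 'm set \<Rightarrow> 'm letter list \<Rightarrow> 'm letter list \<Rightarrow> bool" for K S
where
  rule_id: "X \<in> Obj K \<Longrightarrow> zigzag_rule K S [Fwd (Idt K X)] []"
| rule_cmp: "\<lbrakk>f \<in> Hom K X Y; g \<in> Hom K Y Z\<rbrakk>
              \<Longrightarrow> zigzag_rule K S [Fwd f, Fwd g] [Fwd (g \<odot>\<^bsub>K\<^esub> f)]"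
| rule_inv_right: "s \<in> S \<Longrightarrow> zigzag_rule K S [Fwd s, Bwd s] []"
| rule_inv_left: "s \<in> S \<Longrightarrow> zigzag_rule K S [Bwd s, Fwd s] []"

definition zigzag_step ::
  "('o, 'm, 'x) cat_scheme \<Rightarrow> 'm set \<Rightarrow> 'o \<Rightarrow> 'o \<Rightarrow> ('m letter list \<times> 'm letter list) set" where
  "zigzag_step K S X Y = {(a @ u @ b, a @ v @ b) | a b u v.
     zigzag_rule K S u v \<and> zigzag K S X (a @ u @ b) Y \<and> zigzag K S X (a @ v @ b) Y}"

definition zigzag_eq ::
  "('o, 'm, 'x) cat_scheme \<Rightarrow> 'm set \<Rightarrow> 'o \<Rightarrow> 'o \<Rightarrow> ('m letter list \<times> 'm letter list) set" where
  "zigzag_eq K S X Y = (zigzag_step K S X Y \<union> (zigzag_step K S X Y)\<inverse>)\<^sup>*"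

type_synonym ('o, 'm) larr = "'o \<times> 'm letter list set \<times> 'o"

definition zigzag_class ::
  "('o, 'm, 'x) cat_scheme \<Rightarrow> 'm set \<Rightarrow> 'o \<Rightarrow> 'o \<Rightarrow> 'm letter list \<Rightarrow> ('o, 'm) larr" where
  "zigzag_class K S X Y w = (X, zigzag_eq K S X Y `` {w}, Y)"

definition localization ::
  "('o, 'm, 'x) cat_scheme \<Rightarrow> 'm set \<Rightarrow> ('o, ('o, 'm) larr) cat" where
  "localization K S = \<lparr>
     Obj = Obj K,
     Arr = {zigzag_class K S X Y w | X Y w. zigzag K S X w Y},
     Src = (\<lambda>(X, _, _). X),
     Tgt = (\<lambda>(_, _, Y). Y),
     Idt = (\<lambda>X. zigzag_class K S X X []),
     Cmp = (\<lambda>(_, G, Z) (X, F, _).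
              (X, zigzag_eq K S X Z `` {u @ v | u v. u \<in> F \<and> v \<in> G}, Z))\<rparr>"

definition roof ::
  "('o, 'm, 'x) cat_scheme \<Rightarrow> 'm set \<Rightarrow> 'm \<Rightarrow> 'm \<Rightarrow> ('o, 'm) larr" where
  "roof K S s g = zigzag_class K S (Tgt K s) (Tgt K g) [Bwd s, Fwd g]"

type_synonym ('o, 'm) darr = "(('o, 'm) cx, ('o, 'm) karr) larr"

definition derived_cat ::
  "('o, 'm, 'x) precat_scheme \<Rightarrow> (('o, 'm) cx, ('o, 'm) darr) cat" where
  "derived_cat C = localization (homotopy_cat C) (quasi_isos C)"

text \<open>The shift does not change the sign of the differential. It is isomorphic to the shift
  with differential \<open>(-1)\<^sup>i d\<close>, through \<open>(-1)\<^sup>i\<^sup>n\<close> in degree \<open>n\<close>, and both give the same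
  complex on an object placed in a single degree. They differ on arrows: with the signs, and
  with Yoneda classes given by roofs with unsigned maps as below, splicing two short exact
  sequences would give minus the product of their classes.\<close>

definition shift :: "int \<Rightarrow> ('o, 'm) cx \<Rightarrow> ('o, 'm) cx" where
  "shift i X = \<lparr>ob = (\<lambda>n. ob X (n + i)), df = (\<lambda>n. df X (n + i))\<rparr>"

definition shift_karr :: "int \<Rightarrow> ('o, 'm) karr \<Rightarrow> ('o, 'm) karr" where
  "shift_karr i = (\<lambda>(X, F, Y). (shift i X, (\<lambda>f n. f (n + i)) ` F, shift i Y))"

definition shift_darr ::
  "('o, 'm, 'x) precat_scheme \<Rightarrow> int \<Rightarrow> ('o, 'm) darr \<Rightarrow> ('o, 'm) darr" where
  "shift_darr C i = (\<lambda>(X, F, Y).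
     (shift i X,
      zigzag_eq (homotopy_cat C) (quasi_isos C) (shift i X) (shift i Y)
        `` (map (map_letter (shift_karr i)) ` F),
      shift i Y))"

definition stalk :: "('o, 'm, 'x) precat_scheme \<Rightarrow> 'o \<Rightarrow> ('o, 'm) cx" where
  "stalk C A =
     (let X = (\<lambda>n::int. if n = 0 then A else zero_obj C)
      in \<lparr>ob = X, df = (\<lambda>n. Zero C (X n) (X (n + 1)))\<rparr>)"

definition Ext :: "('o, 'm, 'x) precat_scheme \<Rightarrow> nat \<Rightarrow> 'o \<Rightarrow> 'o \<Rightarrow> ('o, 'm) darr set" where
  "Ext C i A B = Hom (derived_cat C) (stalk C A) (shift (int i) (stalk C B))"

definition yoneda_product ::
  "('o, 'm, 'x) precat_scheme \<Rightarrow> ('o, 'm) darr \<Rightarrow> ('o, 'm) darr \<Rightarrow> ('o, 'm) darr" where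
  "yoneda_product C \<alpha>1 \<alpha>2 = shift_darr C 1 \<alpha>1 \<odot>\<^bsub>derived_cat C\<^esub> \<alpha>2"

text \<open>The maps \<open>B \<rightarrow> E\<^sub>i \<rightarrow> \<dots> \<rightarrow> E\<^sub>1 \<rightarrow> A\<close> are given as a list \<open>ms\<close> of length \<open>i + 1\<close>, so that
  the object in degree \<open>n\<close> of \<open>B \<rightarrow> E\<^sub>i \<rightarrow> \<dots> \<rightarrow> E\<^sub>1\<close> is the source of \<open>ms ! (n + i)\<close>.\<close>

definition yoneda_degree :: "'m list \<Rightarrow> int" where
  "yoneda_degree ms = int (length ms) - 1"

definition yoneda_cx :: "('o, 'm, 'x) precat_scheme \<Rightarrow> 'm list \<Rightarrow> ('o, 'm) cx" where
  "yoneda_cx C ms =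
     (let i = yoneda_degree ms;
          L = (\<lambda>n::int. if - i \<le> n \<and> n \<le> 0 then Src C (ms ! nat (n + i)) else zero_obj C)
      in \<lparr>ob = L,
          df = (\<lambda>n. if - i \<le> n \<and> n < 0 then ms ! nat (n + i) else Zero C (L n) (L (n + 1)))\<rparr>)"

definition yoneda_s :: "('o, 'm, 'x) precat_scheme \<Rightarrow> 'm list \<Rightarrow> ('o, 'm) karr" where
  "yoneda_s C ms =
     (let L = yoneda_cx C ms; A = stalk C (Tgt C (last ms))
      in homotopy_class C L A (\<lambda>n. if n = 0 then last ms else Zero C (ob L n) (ob A n)))"

definition yoneda_g :: "('o, 'm, 'x) precat_scheme \<Rightarrow> 'm list \<Rightarrow> ('o, 'm) karr" where
  "yoneda_g C ms =
     (let L = yoneda_cx C ms; i = yoneda_degree ms; B = Src C (hd ms);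
          Bi = shift i (stalk C B)
      in homotopy_class C L Bi (\<lambda>n. if n = - i then Idt C B else Zero C (ob L n) (ob Bi n)))"

definition yoneda_class :: "('o, 'm, 'x) precat_scheme \<Rightarrow> 'm list \<Rightarrow> ('o, 'm) darr" where
  "yoneda_class C ms = roof (homotopy_cat C) (quasi_isos C) (yoneda_s C ms) (yoneda_g C ms)"

end

theory Submission
  imports Defs
begin

text \<open>The Yoneda complex \<open>L = (F1 \<rightarrow> F2 \<rightarrow> G/F1)\<close> of the four-term sequence maps by a chain map \<open>t\<close>
  to \<open>L2 = (F2/F1 \<rightarrow> G/F1)\<close> and by a chain map \<open>u\<close> to \<open>L1[1] = (F1 \<rightarrow> F2)[1]\<close>. With the roofs
  \<open>(s, g)\<close>, \<open>(s2, g2)\<close>, \<open>(s1, g1)\<close> of the three sequences, \<open>s = s2 t\<close>, \<open>g = g1[1] u\<close> and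
  \<open>g2 t = s1[1] u\<close> hold already for chain maps. Since \<open>s2\<close> and \<open>s1[1]\<close> are quasi-isomorphisms,
  \<open>g s\<inverse> = g1[1] s1[1]\<inverse> s1[1] u s\<inverse> = g1[1] s1[1]\<inverse> g2 t s\<inverse> = (g1[1] s1[1]\<inverse>) (g2 s2\<inverse>)\<close>.
  The last equality is \<open>s2 t s\<inverse> = 1\<close>; it needs no calculus of fractions.\<close>

section \<open>Categories and preadditive categories\<close>

text \<open>The maps come from the factorization \<open>f = m \<odot> r\<close>, with
  \<open>r\<close> the projection F2 -> F2/F1 and \<open>m\<close> the induced map F2/F1 -> G/F1. In
  degrees -2, -1, 0, \<open>t\<close> is zero, \<open>r\<close>, identity, which commutes with the
  differentials because \<open>r\<close> kills F1; \<open>u\<close> is identity, identity, zero.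
  Since the shift carries no sign, L1[1] and L share the differential F1 -> F2, so \<open>u\<close>
  needs no sign either, and both sides of the square are \<open>r\<close> in degree -1 and zero
  elsewhere. The weight lies in the inputs. The localization inverts only members of
  \<open>quasi_isos\<close>, defined through cohomology built from chosen kernels and cokernels, so
  that \<open>s\<close>, \<open>s1\<close>, \<open>s2\<close> belong there has to be derived from
  the axioms of an abelian category: off degree 0 exactness kills cohomology, and in degree 0 the
  last arrow of the sequence is a cokernel of the last differential. Exactness of the sequences in
  turn needs \<open>m\<close> to be monic, where normality of epimorphisms enters.\<close>

lemma homD:
  assumes "f \<in> Hom C A B"
  shows "f \<in> Arr C" "Src C f = A" "Tgt C f = B"
  using assms by (simp_all add: Hom_def)

context category
begin

lemma hom_objs: "f \<in> Hom C A B \<Longrightarrow> A \<in> Obj C" "f \<in> Hom C A B \<Longrightarrow> B \<in> Obj C"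
  using src_obj tgt_obj by (auto simp: Hom_def)

lemma monicD:
  assumes "monic C f" "f \<in> Hom C A B" "x \<in> Hom C X A" "y \<in> Hom C X A" "f \<odot> x = f \<odot> y"
  shows "x = y"
  using assms by (auto simp: monic_def Hom_def)

lemma epicD:
  assumes "epic C f" "f \<in> Hom C A B" "x \<in> Hom C B X" "y \<in> Hom C B X" "x \<odot> f = y \<odot> f"
  shows "x = y"
  using assms by (auto simp: epic_def Hom_def)

lemma monicI:
  assumes "f \<in> Hom C A B"
    and "\<And>X x y. x \<in> Hom C X A \<Longrightarrow> y \<in> Hom C X A \<Longrightarrow> f \<odot> x = f \<odot> y \<Longrightarrow> x = y"
  shows "monic C f"
proof -
  have f: "f \<in> Arr C" "Src C f = A"
    using assms(1) by (simp_all add: Hom_def)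
  show ?thesis
    unfolding monic_def f(2) using f(1) assms(2) by blast
qed

lemma epicI:
  assumes "f \<in> Hom C A B"
    and "\<And>X x y. x \<in> Hom C B X \<Longrightarrow> y \<in> Hom C B X \<Longrightarrow> x \<odot> f = y \<odot> f \<Longrightarrow> x = y"
  shows "epic C f"
proof -
  have f: "f \<in> Arr C" "Tgt C f = B"
    using assms(1) by (simp_all add: Hom_def)
  show ?thesis
    unfolding epic_def f(2) using f(1) assms(2) by blast
qed

lemma epic_cmp:
  assumes "epic C f" "f \<in> Hom C A B" "epic C g" "g \<in> Hom C B D"
  shows "epic C (g \<odot> f)"
proof -
  have gf: "g \<odot> f \<in> Hom C A D"
    using assms cmp_hom by blast
  have "x = y" if "x \<in> Hom C D X" "y \<in> Hom C D X" "x \<odot> (g \<odot> f) = y \<odot> (g \<odot> f)" for x y X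
  proof -
    have "(x \<odot> g) \<odot> f = (y \<odot> g) \<odot> f"
      using that assms by (simp add: cmp_assoc)
    then have "x \<odot> g = y \<odot> g"
      using epicD[OF assms(1,2)] cmp_hom[OF assms(4)] that(1,2) by blast
    then show ?thesis
      using epicD[OF assms(3,4)] that(1,2) by blast
  qed
  then show ?thesis
    by (rule epicI[OF gf])
qed

lemma monic_cmp:
  assumes "monic C f" "f \<in> Hom C A B" "monic C g" "g \<in> Hom C B D"
  shows "monic C (g \<odot> f)"
proof -
  have gf: "g \<odot> f \<in> Hom C A D"
    using assms cmp_hom by blast
  have "x = y" if "x \<in> Hom C X A" "y \<in> Hom C X A" "(g \<odot> f) \<odot> x = (g \<odot> f) \<odot> y" for x y X
  proof -
    have "g \<odot> (f \<odot> x) = g \<odot> (f \<odot> y)"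
      using that assms by (simp add: cmp_assoc)
    then have "f \<odot> x = f \<odot> y"
      using monicD[OF assms(3,4)] cmp_hom[OF _ assms(2)] that(1,2) by blast
    then show ?thesis
      using monicD[OF assms(1,2)] that(1,2) by blast
  qed
  then show ?thesis
    by (rule monicI[OF gf])
qed

lemma epic_second:
  assumes "f \<in> Hom C A B" "g \<in> Hom C B D" "epic C (g \<odot> f)"
  shows "epic C g"
proof -
  have "x = y" if "x \<in> Hom C D X" "y \<in> Hom C D X" "x \<odot> g = y \<odot> g" for x y X
    by (rule epicD[OF assms(3) cmp_hom[OF assms(1,2)] that(1,2)])
      (use cmp_assoc[OF assms(1,2) that(1)] cmp_assoc[OF assms(1,2) that(2)] that(3) in simp)
  then show ?thesis
    by (rule epicI[OF assms(2)])
qed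

lemma monic_retract:
  assumes "f \<in> Hom C A B" "g \<in> Hom C B A" "g \<odot> f = Idt C A"
  shows "monic C f"
proof -
  have "x = y" if "x \<in> Hom C X A" "y \<in> Hom C X A" "f \<odot> x = f \<odot> y" for x y X
    using cmp_assoc[OF that(1) assms(1,2)] cmp_assoc[OF that(2) assms(1,2)]
      cmp_idt_left[OF that(1)] cmp_idt_left[OF that(2)] assms(3) that(3) by argo
  then show ?thesis
    by (rule monicI[OF assms(1)])
qed

lemma epic_section:
  assumes "f \<in> Hom C A B" "g \<in> Hom C B A" "f \<odot> g = Idt C B"
  shows "epic C f"
proof -
  have "x = y" if "x \<in> Hom C B X" "y \<in> Hom C B X" "x \<odot> f = y \<odot> f" for x y X
    using cmp_assoc[OF assms(2,1) that(1)] cmp_assoc[OF assms(2,1) that(2)]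
      cmp_idt_right[OF that(1)] cmp_idt_right[OF that(2)] assms(3) that(3) by argo
  then show ?thesis
    by (rule epicI[OF assms(1)])
qed

lemma isomorphismI:
  assumes "f \<in> Hom C A B" "g \<in> Hom C B A" "g \<odot> f = Idt C A" "f \<odot> g = Idt C B"
  shows "isomorphism C f"
proof -
  have "f \<in> Arr C" "Src C f = A" "Tgt C f = B"
    using assms(1) by (simp_all add: Hom_def)
  then show ?thesis
    unfolding isomorphism_def using assms(2-4) by blast
qed

end

section \<open>Hom groups and their compatibility with composition\<close>

context preadditive_category
begin

lemma hom_group_simps [simp]:
  "carrier (hom_group C A B) = Hom C A B"
  "f \<otimes>\<^bsub>hom_group C A B\<^esub> g = Add C f g"
  "\<one>\<^bsub>hom_group C A B\<^esub> = Zero C A B"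
  by (simp_all add: hom_group_def)

lemma hom_group_comm_group: "f \<in> Hom C A B \<Longrightarrow> comm_group (hom_group C A B)"
  using hom_comm_group hom_objs by blast

lemma hom_group_monoid: "f \<in> Hom C A B \<Longrightarrow> monoid (hom_group C A B)"
  using hom_group_comm_group comm_group.axioms(2) group.is_monoid by blast

lemma zero_hom [intro]:
  assumes "A \<in> Obj C" "B \<in> Obj C"
  shows "Zero C A B \<in> Hom C A B"
  using monoid.one_closed[OF group.is_monoid[OF comm_group.axioms(2)[OF hom_comm_group[OF assms]]]]
  by simp

lemma add_hom:
  assumes "f \<in> Hom C A B" "g \<in> Hom C A B"
  shows "Add C f g \<in> Hom C A B"
  using monoid.m_closed[OF hom_group_monoid[OF assms(1)]] assms by simp

lemma add_assoc:
  assumes "f \<in> Hom C A B" "g \<in> Hom C A B" "h \<in> Hom C A B"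
  shows "Add C (Add C f g) h = Add C f (Add C g h)"
  using monoid.m_assoc[OF hom_group_monoid[OF assms(1)]] assms by simp

lemma add_comm:
  assumes "f \<in> Hom C A B" "g \<in> Hom C A B"
  shows "Add C f g = Add C g f"
  using comm_monoid.m_comm[OF comm_group.axioms(1)[OF hom_group_comm_group[OF assms(1)]]] assms
  by simp

lemma add_left_comm:
  assumes "f \<in> Hom C A B" "g \<in> Hom C A B" "h \<in> Hom C A B"
  shows "Add C f (Add C g h) = Add C g (Add C f h)"
  using comm_monoid.m_lcomm[OF comm_group.axioms(1)[OF hom_group_comm_group[OF assms(1)]]] assms
  by simp

lemma add_zero:
  assumes "f \<in> Hom C A B"
  shows "Add C f (Zero C A B) = f"
  using monoid.r_one[OF hom_group_monoid[OF assms]] assms by simp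

lemma add_cancel:
  assumes "f \<in> Hom C A B" "g \<in> Hom C A B" "h \<in> Hom C A B" "Add C f g = Add C f h"
  shows "g = h"
  using monoid.Units_l_cancel[OF hom_group_monoid[OF assms(1)]] assms
    group.Units_eq[OF comm_group.axioms(2)[OF hom_group_comm_group[OF assms(1)]]] by simp

definition neg :: "'o \<Rightarrow> 'o \<Rightarrow> 'm \<Rightarrow> 'm" where
  "neg A B f = inv\<^bsub>hom_group C A B\<^esub> f"

lemma neg_hom:
  assumes "f \<in> Hom C A B"
  shows "neg A B f \<in> Hom C A B"
  using group.inv_closed[OF comm_group.axioms(2)[OF hom_group_comm_group[OF assms(1)]]] assms
  by (simp add: neg_def)

lemma add_neg:
  assumes "f \<in> Hom C A B"
  shows "Add C f (neg A B f) = Zero C A B"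
  using group.r_inv[OF comm_group.axioms(2)[OF hom_group_comm_group[OF assms(1)]]] assms
  by (simp add: neg_def)

text \<open>The axioms state bilinearity; compatibility with zero follows, because
  \<open>h \<odot> 0 = h \<odot> (0 + 0)\<close> equals its own double and can be cancelled.\<close>

lemma cmp_zero_right:
  assumes "h \<in> Hom C B D" "A \<in> Obj C"
  shows "h \<odot> Zero C A B = Zero C A D"
proof -
  have z: "Zero C A B \<in> Hom C A B"
    using assms hom_objs by blast
  then have hz: "h \<odot> Zero C A B \<in> Hom C A D"
    using assms cmp_hom by blast
  have "Add C (h \<odot> Zero C A B) (h \<odot> Zero C A B) = h \<odot> Zero C A B"
    using cmp_add_right[OF z z assms(1)] add_zero[OF z] by simp
  then show ?thesis
    using add_cancel[OF hz hz zero_hom] add_zero[OF hz] hom_objs[OF hz] by simp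
qed

lemma cmp_zero_left:
  assumes "h \<in> Hom C A B" "D \<in> Obj C"
  shows "Zero C B D \<odot> h = Zero C A D"
proof -
  have z: "Zero C B D \<in> Hom C B D"
    using assms hom_objs by blast
  then have hz: "Zero C B D \<odot> h \<in> Hom C A D"
    using assms cmp_hom by blast
  have "Add C (Zero C B D \<odot> h) (Zero C B D \<odot> h) = Zero C B D \<odot> h"
    using cmp_add_left[OF assms(1) z z] add_zero[OF z] by simp
  then show ?thesis
    using add_cancel[OF hz hz zero_hom] add_zero[OF hz] hom_objs[OF hz] by simp
qed

section \<open>Kernels and cokernels as universal arrows\<close>

lemma is_kernelI:
  assumes "k \<in> Hom C K A" "f \<in> Hom C A B" "f \<odot> k = Zero C K B"
    and "\<And>X g. g \<in> Hom C X A \<Longrightarrow> f \<odot> g = Zero C X B \<Longrightarrow> \<exists>z \<in> Hom C X K. k \<odot> z = g"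
    and "monic C k"
  shows "is_kernel C k f"
  unfolding is_kernel_def
proof (intro conjI ballI impI)
  fix g assume "g \<in> Arr C" "Tgt C g = Src C f \<and> f \<odot> g = Zero C (Src C g) (Tgt C f)"
  then have g: "g \<in> Hom C (Src C g) A" "f \<odot> g = Zero C (Src C g) B"
    using assms(2) by (auto simp: Hom_def)
  then obtain z where z: "z \<in> Hom C (Src C g) K" "k \<odot> z = g"
    using assms(4) by blast
  have k: "Src C k = K"
    using assms(1) by (simp add: Hom_def)
  show "\<exists>!z. z \<in> Hom C (Src C g) (Src C k) \<and> k \<odot> z = g"
  proof (rule ex1I)
    show "z \<in> Hom C (Src C g) (Src C k) \<and> k \<odot> z = g"
      using z k by simp
    show "w = z" if "w \<in> Hom C (Src C g) (Src C k) \<and> k \<odot> w = g" for w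
      by (rule monicD[OF assms(5,1) _ z(1)]) (use that z k in simp_all)
  qed
qed (use assms(1-3) in \<open>auto simp: Hom_def\<close>)

lemma is_cokernelI:
  assumes "c \<in> Hom C B D" "f \<in> Hom C A B" "c \<odot> f = Zero C A D"
    and "\<And>X g. g \<in> Hom C B X \<Longrightarrow> g \<odot> f = Zero C A X \<Longrightarrow> \<exists>u \<in> Hom C D X. u \<odot> c = g"
    and "epic C c"
  shows "is_cokernel C c f"
  unfolding is_cokernel_def
proof (intro conjI ballI impI)
  fix g assume "g \<in> Arr C" "Src C g = Tgt C f \<and> g \<odot> f = Zero C (Src C f) (Tgt C g)"
  then have g: "g \<in> Hom C B (Tgt C g)" "g \<odot> f = Zero C A (Tgt C g)"
    using assms(2) by (auto simp: Hom_def)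
  then obtain u where u: "u \<in> Hom C D (Tgt C g)" "u \<odot> c = g"
    using assms(4) by blast
  have c: "Tgt C c = D"
    using assms(1) by (simp add: Hom_def)
  show "\<exists>!u. u \<in> Hom C (Tgt C c) (Tgt C g) \<and> u \<odot> c = g"
  proof (rule ex1I)
    show "u \<in> Hom C (Tgt C c) (Tgt C g) \<and> u \<odot> c = g"
      using u c by simp
    show "w = u" if "w \<in> Hom C (Tgt C c) (Tgt C g) \<and> w \<odot> c = g" for w
      by (rule epicD[OF assms(5,1) _ u(1)]) (use that u c in simp_all)
  qed
qed (use assms(1-3) in \<open>auto simp: Hom_def\<close>)

lemma kernel_cmp:
  assumes "is_kernel C k f" "k \<in> Hom C K A" "f \<in> Hom C A B"
  shows "f \<odot> k = Zero C K B"
  using assms by (auto simp: is_kernel_def Hom_def)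

lemma kernel_hom:
  assumes "is_kernel C k f" "f \<in> Hom C A B"
  shows "k \<in> Hom C (Src C k) A"
  using assms by (auto simp: is_kernel_def Hom_def)

lemma cokernel_hom:
  assumes "is_cokernel C c f" "f \<in> Hom C A B"
  shows "c \<in> Hom C B (Tgt C c)"
  using assms by (auto simp: is_cokernel_def Hom_def)

lemma kernel_ex1:
  assumes "is_kernel C k f" "k \<in> Hom C K A" "f \<in> Hom C A B" "g \<in> Hom C X A"
    "f \<odot> g = Zero C X B"
  shows "\<exists>!z. z \<in> Hom C X K \<and> k \<odot> z = g"
proof -
  have "g \<in> Arr C" "Src C g = X" "Tgt C g = A" "Src C f = A" "Tgt C f = B" "Src C k = K"
    using assms(2-4) by (auto simp: Hom_def)
  moreover from assms(1) have "\<forall>g \<in> Arr C. Tgt C g = Src C f \<and> f \<odot> g = Zero C (Src C g) (Tgt C f)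
      \<longrightarrow> (\<exists>!z. z \<in> Hom C (Src C g) (Src C k) \<and> k \<odot> z = g)"
    unfolding is_kernel_def by blast
  from bspec[OF this, of g] assms(5) calculation show ?thesis
    by simp
qed

lemma cokernel_cmp:
  assumes "is_cokernel C c f" "c \<in> Hom C B D" "f \<in> Hom C A B"
  shows "c \<odot> f = Zero C A D"
  using assms by (auto simp: is_cokernel_def Hom_def)

lemma cokernel_ex1:
  assumes "is_cokernel C c f" "c \<in> Hom C B D" "f \<in> Hom C A B" "g \<in> Hom C B X"
    "g \<odot> f = Zero C A X"
  shows "\<exists>!u. u \<in> Hom C D X \<and> u \<odot> c = g"
proof -
  have "g \<in> Arr C" "Src C g = B" "Tgt C g = X" "Src C f = A" "Tgt C f = B" "Tgt C c = D"
    using assms(2-4) by (auto simp: Hom_def)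
  moreover from assms(1) have "\<forall>g \<in> Arr C. Src C g = Tgt C f \<and> g \<odot> f = Zero C (Src C f) (Tgt C g)
      \<longrightarrow> (\<exists>!u. u \<in> Hom C (Tgt C c) (Tgt C g) \<and> u \<odot> c = g)"
    unfolding is_cokernel_def by blast
  from bspec[OF this, of g] assms(5) calculation show ?thesis
    by simp
qed

lemma kernel_monic:
  assumes "is_kernel C k f"
  shows "monic C k"
proof -
  obtain K A B where k: "k \<in> Hom C K A" and f: "f \<in> Hom C A B"
    using assms by (auto simp: is_kernel_def Hom_def)
  have "x = y" if x: "x \<in> Hom C X K" and y: "y \<in> Hom C X K" and eq: "k \<odot> x = k \<odot> y" for x y X
  proof -
    have "f \<odot> (k \<odot> x) = Zero C X B"
      using cmp_assoc[OF x k f] kernel_cmp[OF assms k f] cmp_zero_left[OF x] hom_objs[OF f] by simp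
    then show ?thesis
      using kernel_ex1[OF assms k f cmp_hom[OF x k]] x y eq[symmetric] by blast
  qed
  then show ?thesis
    by (rule monicI[OF k])
qed

lemma cokernel_epic:
  assumes "is_cokernel C c f"
  shows "epic C c"
proof -
  obtain A B D where c: "c \<in> Hom C B D" and f: "f \<in> Hom C A B"
    using assms by (auto simp: is_cokernel_def Hom_def)
  have "x = y" if x: "x \<in> Hom C D X" and y: "y \<in> Hom C D X" and eq: "x \<odot> c = y \<odot> c" for x y X
  proof -
    have "(x \<odot> c) \<odot> f = Zero C A X"
      using cmp_assoc[OF f c x] cokernel_cmp[OF assms c f] cmp_zero_right[OF x] hom_objs[OF f]
      by simp
    then show ?thesis
      using cokernel_ex1[OF assms c f cmp_hom[OF c x]] x y eq[symmetric] by blast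
  qed
  then show ?thesis
    by (rule epicI[OF c])
qed

lemma lift_props:
  assumes "is_kernel C k f" "k \<in> Hom C K A" "f \<in> Hom C A B" "g \<in> Hom C X A"
    "f \<odot> g = Zero C X B"
  shows "lift C k g \<in> Hom C X K" "k \<odot> lift C k g = g"
proof -
  have "Src C g = X" "Src C k = K"
    using assms by (auto simp: Hom_def)
  then show "lift C k g \<in> Hom C X K" "k \<odot> lift C k g = g"
    using theI'[OF kernel_ex1[OF assms]] by (auto simp: lift_def)
qed

lemma colift_props:
  assumes "is_cokernel C c f" "c \<in> Hom C B D" "f \<in> Hom C A B" "g \<in> Hom C B X"
    "g \<odot> f = Zero C A X"
  shows "colift C c g \<in> Hom C D X" "colift C c g \<odot> c = g"
proof -
  have "Tgt C g = X" "Tgt C c = D"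
    using assms by (auto simp: Hom_def)
  then show "colift C c g \<in> Hom C D X" "colift C c g \<odot> c = g"
    using theI'[OF cokernel_ex1[OF assms]] by (auto simp: colift_def)
qed

text \<open>Subtraction reduces cancellation to the zero test: with \<open>z\<close> the negative of
  \<open>y\<close>, the arrow \<open>x + z\<close> is killed by \<open>f\<close>, hence
  zero.\<close>

lemma monicI_zero:
  assumes "f \<in> Hom C A B"
    and "\<And>X x. x \<in> Hom C X A \<Longrightarrow> f \<odot> x = Zero C X B \<Longrightarrow> x = Zero C X A"
  shows "monic C f"
proof -
  have "x = y" if x: "x \<in> Hom C X A" and y: "y \<in> Hom C X A" and eq: "f \<odot> x = f \<odot> y" for x y X
  proof -
    obtain z where z: "z \<in> Hom C X A" "Add C y z = Zero C X A"
      using neg_hom[OF y] add_neg[OF y] by blast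
    have "f \<odot> Add C x z = f \<odot> Add C y z"
      using cmp_add_right[OF x z(1) assms(1)] cmp_add_right[OF y z(1) assms(1)] eq by simp
    also have "\<dots> = Zero C X B"
      using z cmp_zero_right[OF assms(1)] hom_objs[OF x] by simp
    finally have "Add C x z = Zero C X A"
      using assms(2) add_hom[OF x z(1)] by blast
    then show ?thesis
      using add_cancel[OF z(1) x y] add_comm[OF x z(1)] add_comm[OF y z(1)] z(2) by simp
  qed
  then show ?thesis
    by (rule monicI[OF assms(1)])
qed

lemma epicI_zero:
  assumes "f \<in> Hom C A B"
    and "\<And>X x. x \<in> Hom C B X \<Longrightarrow> x \<odot> f = Zero C A X \<Longrightarrow> x = Zero C B X"
  shows "epic C f"
proof -
  have "x = y" if x: "x \<in> Hom C B X" and y: "y \<in> Hom C B X" and eq: "x \<odot> f = y \<odot> f" for x y X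
  proof -
    obtain z where z: "z \<in> Hom C B X" "Add C y z = Zero C B X"
      using neg_hom[OF y] add_neg[OF y] by blast
    have "Add C x z \<odot> f = Add C y z \<odot> f"
      using cmp_add_left[OF assms(1) x z(1)] cmp_add_left[OF assms(1) y z(1)] eq by simp
    also have "\<dots> = Zero C A X"
      using z cmp_zero_left[OF assms(1)] hom_objs[OF x] by simp
    finally have "Add C x z = Zero C B X"
      using assms(2) add_hom[OF x z(1)] by blast
    then show ?thesis
      using add_cancel[OF z(1) x y] add_comm[OF x z(1)] add_comm[OF y z(1)] z(2) by simp
  qed
  then show ?thesis
    by (rule epicI[OF assms(1)])
qed

text \<open>The two comparison arrows are mutually inverse, since cokernels are epic. This is how a
  map on cohomology is recognized as invertible later: it suffices that the composite it descends
  from is another cokernel of the same arrow.\<close>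

lemma colift_cokernel_iso:
  assumes "is_cokernel C c f" "c \<in> Hom C B D" "is_cokernel C c' f" "c' \<in> Hom C B D'" "f \<in> Hom C A B"
  shows "isomorphism C (colift C c c')"
proof -
  note u = colift_props[OF assms(1,2,5,4) cokernel_cmp[OF assms(3,4,5)]]
  note v = colift_props[OF assms(3,4,5,2) cokernel_cmp[OF assms(1,2,5)]]
  have "(colift C c' c \<odot> colift C c c') \<odot> c = Idt C D \<odot> c"
    using cmp_assoc[OF assms(2) u(1) v(1)] cmp_idt_left[OF assms(2)] u(2) v(2) by simp
  then have "colift C c' c \<odot> colift C c c' = Idt C D"
    by (rule epicD[OF cokernel_epic[OF assms(1)] assms(2) cmp_hom[OF u(1) v(1)]
          idt_hom[OF hom_objs(1)[OF u(1)]]])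
  moreover have "(colift C c c' \<odot> colift C c' c) \<odot> c' = Idt C D' \<odot> c'"
    using cmp_assoc[OF assms(4) v(1) u(1)] cmp_idt_left[OF assms(4)] u(2) v(2) by simp
  then have "colift C c c' \<odot> colift C c' c = Idt C D'"
    by (rule epicD[OF cokernel_epic[OF assms(3)] assms(4) cmp_hom[OF v(1) u(1)]
          idt_hom[OF hom_objs(1)[OF v(1)]]])
  ultimately show ?thesis
    using u v isomorphismI by blast
qed

end

lemma (in preadditive_category) idt_kernel_zero:
  assumes "A \<in> Obj C" "B \<in> Obj C"
  shows "is_kernel C (Idt C A) (Zero C A B)"
proof (rule is_kernelI[OF idt_hom[OF assms(1)] zero_hom[OF assms]])
  show "Zero C A B \<odot> Idt C A = Zero C A B"
    by (rule cmp_idt_right[OF zero_hom[OF assms]])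
  show "\<exists>z \<in> Hom C X A. Idt C A \<odot> z = g" if "g \<in> Hom C X A" for X g
    using that cmp_idt_left by blast
  show "monic C (Idt C A)"
    using monic_retract[OF idt_hom[OF assms(1)] idt_hom[OF assms(1)]]
      cmp_idt_left[OF idt_hom[OF assms(1)]] by blast
qed

lemma (in preadditive_category) idt_cokernel_zero:
  assumes "A \<in> Obj C" "B \<in> Obj C"
  shows "is_cokernel C (Idt C B) (Zero C A B)"
proof (rule is_cokernelI[OF idt_hom[OF assms(2)] zero_hom[OF assms]])
  show "Idt C B \<odot> Zero C A B = Zero C A B"
    by (rule cmp_idt_left[OF zero_hom[OF assms]])
  show "\<exists>u \<in> Hom C B X. u \<odot> Idt C B = g" if "g \<in> Hom C B X" for X g
    using that cmp_idt_right by blast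
  show "epic C (Idt C B)"
    using epic_section[OF idt_hom[OF assms(2)] idt_hom[OF assms(2)]]
      cmp_idt_left[OF idt_hom[OF assms(2)]] by blast
qed

text \<open>Two kernels of \<open>g\<close> factor through each other, and so kill and absorb the
  same arrows. \<open>exact_at\<close> only provides some common kernel \<open>k\<close>; this
  passes from it to a prescribed one, such as the chosen \<open>ker\<close> or an identity.\<close>

lemma (in preadditive_category) kernel_transfer:
  assumes k: "is_kernel C k f" "is_kernel C k g" "is_kernel C k' g" and g: "g \<in> Hom C A B"
  shows "is_kernel C k' f"
proof -
  have kA: "k \<in> Hom C (Src C k) A" and k'A: "k' \<in> Hom C (Src C k') A"
    using kernel_hom[OF k(2) g] kernel_hom[OF k(3) g] .
  have "Src C f = A"
    using k(1) homD(3)[OF kA] by (simp add: is_kernel_def)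
  then obtain D where f: "f \<in> Hom C A D"
    using k(1) by (auto simp: is_kernel_def Hom_def)
  show ?thesis
  proof (rule is_kernelI[OF k'A f _ _ kernel_monic[OF k(3)]])
    obtain u where u: "u \<in> Hom C (Src C k') (Src C k)" "k \<odot> u = k'"
      using kernel_ex1[OF k(2) kA g k'A kernel_cmp[OF k(3) k'A g]] by blast
    show "f \<odot> k' = Zero C (Src C k') D"
      using cmp_assoc[OF u(1) kA f] kernel_cmp[OF k(1) kA f] u(2)
        cmp_zero_left[OF u(1) hom_objs(2)[OF f]] by simp
  next
    fix X x assume x: "x \<in> Hom C X A" "f \<odot> x = Zero C X D"
    obtain z where z: "z \<in> Hom C X (Src C k)" "k \<odot> z = x"
      using kernel_ex1[OF k(1) kA f x] by blast
    have "g \<odot> x = Zero C X B"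
      using cmp_assoc[OF z(1) kA g] kernel_cmp[OF k(2) kA g] z(2)
        cmp_zero_left[OF z(1) hom_objs(2)[OF g]] by simp
    then show "\<exists>z \<in> Hom C X (Src C k'). k' \<odot> z = x"
      using kernel_ex1[OF k(3) k'A g x(1)] by blast
  qed
qed

section \<open>Abelian categories and exactness\<close>

context abelian_category
begin

lemma is_zero_obj_zero_obj: "is_zero_obj C (zero_obj C)"
  unfolding zero_obj_def using ex_zero_obj by (rule someI_ex)

lemma zero_obj_Obj [simp]: "zero_obj C \<in> Obj C"
  using is_zero_obj_zero_obj by (simp add: is_zero_obj_def)

lemma hom_zero_obj_unique:
  "f \<in> Hom C A (zero_obj C) \<Longrightarrow> g \<in> Hom C A (zero_obj C) \<Longrightarrow> f = g"
  "f \<in> Hom C (zero_obj C) A \<Longrightarrow> g \<in> Hom C (zero_obj C) A \<Longrightarrow> f = g"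
  using is_zero_obj_zero_obj hom_objs[of f] unfolding is_zero_obj_def by blast+

lemma ker_is_kernel: "f \<in> Arr C \<Longrightarrow> is_kernel C (ker C f) f"
  unfolding ker_def by (rule someI_ex[OF ex_kernel])

lemma coker_is_cokernel: "f \<in> Arr C \<Longrightarrow> is_cokernel C (coker C f) f"
  unfolding coker_def by (rule someI_ex[OF ex_cokernel])

text \<open>By normality \<open>k\<close> is a kernel of some \<open>g\<close>. Since
  \<open>g\<close> kills \<open>k\<close> it factors through \<open>c\<close>, so whatever
  \<open>c\<close> kills is killed by \<open>g\<close> and factors through \<open>k\<close>.\<close>

lemma monic_kernel_cokernel:
  assumes k: "monic C k" and c: "is_cokernel C c k"
  shows "is_kernel C k c"
proof -
  obtain g where g: "is_kernel C k g"
    using monic_normal[OF k] by blast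
  define K A where "K = Src C k" and "A = Tgt C k"
  have kA: "k \<in> Hom C K A"
    using k by (simp add: monic_def Hom_def K_def A_def)
  obtain B where gB: "g \<in> Hom C A B"
    using g by (simp add: is_kernel_def Hom_def A_def)
  have cD: "c \<in> Hom C A (Tgt C c)"
    using cokernel_hom[OF c kA] .
  obtain u where u: "u \<in> Hom C (Tgt C c) B" "u \<odot> c = g"
    using cokernel_ex1[OF c cD kA gB kernel_cmp[OF g kA gB]] by blast
  show ?thesis
  proof (rule is_kernelI[OF kA cD cokernel_cmp[OF c cD kA] _ k])
    fix X x assume x: "x \<in> Hom C X A" "c \<odot> x = Zero C X (Tgt C c)"
    have "g \<odot> x = Zero C X B"
      using cmp_assoc[OF x(1) cD u(1)] u(2) x(2) cmp_zero_right[OF u(1) hom_objs(1)[OF x(1)]]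
      by simp
    then show "\<exists>z \<in> Hom C X K. k \<odot> z = x"
      using kernel_ex1[OF g kA gB x(1)] by blast
  qed
qed

text \<open>Dual to \<open>monic_kernel_cokernel\<close>, with normality of epimorphisms.\<close>

lemma epic_cokernel_kernel:
  assumes c: "epic C c" and k: "is_kernel C k c"
  shows "is_cokernel C c k"
proof -
  obtain g where g: "is_cokernel C c g"
    using epic_normal[OF c] by blast
  define A D where "A = Src C c" and "D = Tgt C c"
  have cD: "c \<in> Hom C A D"
    using c by (simp add: epic_def Hom_def A_def D_def)
  obtain B where gB: "g \<in> Hom C B A"
    using g by (simp add: is_cokernel_def Hom_def A_def)
  have kA: "k \<in> Hom C (Src C k) A"
    using kernel_hom[OF k cD] .
  obtain u where u: "u \<in> Hom C B (Src C k)" "k \<odot> u = g"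
    using kernel_ex1[OF k kA cD gB cokernel_cmp[OF g cD gB]] by blast
  show ?thesis
  proof (rule is_cokernelI[OF cD kA kernel_cmp[OF k kA cD] _ c])
    fix X x assume x: "x \<in> Hom C A X" "x \<odot> k = Zero C (Src C k) X"
    have "x \<odot> g = Zero C B X"
      using cmp_assoc[OF u(1) kA x(1)] u(2) x(2) cmp_zero_left[OF u(1) hom_objs(2)[OF x(1)]]
      by simp
    then show "\<exists>u \<in> Hom C D X. u \<odot> c = x"
      using cokernel_ex1[OF g cD gB x(1)] by blast
  qed
qed

text \<open>If \<open>m \<odot> x = 0\<close> and \<open>c\<close> is a cokernel of \<open>x\<close>, then \<open>m\<close> factors through \<open>c\<close>, so \<open>r\<close> kills the
  kernel of \<open>c \<odot> r\<close> and thus factors through the epimorphism \<open>c \<odot> r\<close>; hence \<open>c\<close> splits and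
  \<open>x = 0\<close>. This avoids pullbacks.\<close>

lemma coimage_map_monic:
  assumes j: "is_kernel C j (m \<odot> r)" and r: "is_cokernel C r j"
    and rA: "r \<in> Hom C A B" and mB: "m \<in> Hom C B D"
  shows "monic C m"
proof (rule monicI_zero[OF mB])
  fix X x assume x: "x \<in> Hom C X B" and mx: "m \<odot> x = Zero C X D"
  define c where "c = coker C x"
  have c: "is_cokernel C c x"
    unfolding c_def using coker_is_cokernel homD(1)[OF x] .
  define E where "E = Tgt C c"
  have cB: "c \<in> Hom C B E"
    using cokernel_hom[OF c x] by (simp add: E_def)
  obtain m' where m': "m' \<in> Hom C E D" "m' \<odot> c = m"
    using cokernel_ex1[OF c cB x mB mx] by blast
  have mr: "m \<odot> r \<in> Hom C A D"
    using cmp_hom[OF rA mB] .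
  have jA: "j \<in> Hom C (Src C j) A"
    using kernel_hom[OF j mr] .
  have cr: "c \<odot> r \<in> Hom C A E"
    using cmp_hom[OF rA cB] .
  have "epic C (c \<odot> r)"
    by (rule epic_cmp[OF cokernel_epic[OF r] rA cokernel_epic[OF c] cB])
  then obtain h where h: "is_cokernel C (c \<odot> r) h"
    using epic_normal by blast
  obtain Y where hY: "h \<in> Hom C Y A"
    using h homD[OF cr] by (auto simp: is_cokernel_def Hom_def)
  have "(m \<odot> r) \<odot> h = m' \<odot> ((c \<odot> r) \<odot> h)"
    using cmp_assoc[OF hY cr m'(1)] cmp_assoc[OF rA cB m'(1)] m'(2) by simp
  also have "\<dots> = Zero C Y D"
    using cokernel_cmp[OF h cr hY] cmp_zero_right[OF m'(1) hom_objs(1)[OF hY]] by simp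
  finally obtain h' where h': "h' \<in> Hom C Y (Src C j)" "j \<odot> h' = h"
    using kernel_ex1[OF j jA mr hY] by blast
  have "r \<odot> h = Zero C Y B"
    using cmp_assoc[OF h'(1) jA rA] h'(2) cokernel_cmp[OF r rA jA]
      cmp_zero_left[OF h'(1) hom_objs(2)[OF rA]] by simp
  then obtain u where u: "u \<in> Hom C E B" "u \<odot> (c \<odot> r) = r"
    using cokernel_ex1[OF h cr hY rA] by blast
  have "u \<odot> c = Idt C B"
    by (rule epicD[OF cokernel_epic[OF r] rA cmp_hom[OF cB u(1)] idt_hom[OF hom_objs(1)[OF mB]]])
      (use cmp_assoc[OF rA cB u(1)] u(2) cmp_idt_left[OF rA] in simp)
  then have "x = u \<odot> (c \<odot> x)"
    using cmp_assoc[OF x cB u(1)] cmp_idt_left[OF x] by simp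
  then show "x = Zero C X B"
    using cokernel_cmp[OF c cB x] cmp_zero_right[OF u(1) hom_objs(1)[OF x]] by simp
qed

text \<open>Dual to \<open>coimage_map_monic\<close>. If \<open>x \<odot> e = 0\<close>, then
  \<open>e\<close> factors through the kernel \<open>l\<close> of \<open>x\<close>. The monic
  \<open>k \<odot> l\<close> is a kernel of some \<open>h\<close>; this \<open>h\<close> kills
  \<open>k \<odot> e\<close>, so it factors through \<open>c\<close> and kills \<open>k\<close>.
  Hence \<open>k\<close> factors through \<open>k \<odot> l\<close>, which gives \<open>l\<close> a
  right inverse and forces \<open>x = 0\<close>.\<close>

lemma image_map_epic:
  assumes c: "is_cokernel C c (k \<odot> e)" and k: "is_kernel C k c"
    and eA: "e \<in> Hom C A B" and kB: "k \<in> Hom C B D"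
  shows "epic C e"
proof (rule epicI_zero[OF eA])
  fix X x assume x: "x \<in> Hom C B X" and xe: "x \<odot> e = Zero C A X"
  define l where "l = ker C x"
  have l: "is_kernel C l x"
    unfolding l_def using ker_is_kernel homD(1)[OF x] .
  define E where "E = Src C l"
  have lB: "l \<in> Hom C E B"
    using kernel_hom[OF l x] by (simp add: E_def)
  obtain e' where e': "e' \<in> Hom C A E" "l \<odot> e' = e"
    using kernel_ex1[OF l lB x eA xe] by blast
  have ke: "k \<odot> e \<in> Hom C A D"
    using cmp_hom[OF eA kB] .
  have cD: "c \<in> Hom C D (Tgt C c)"
    using cokernel_hom[OF c ke] .
  have kl: "k \<odot> l \<in> Hom C E D"
    using cmp_hom[OF lB kB] .
  have "monic C (k \<odot> l)"
    by (rule monic_cmp[OF kernel_monic[OF l] lB kernel_monic[OF k] kB])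
  then obtain h where h: "is_kernel C (k \<odot> l) h"
    using monic_normal by blast
  obtain Y where hY: "h \<in> Hom C D Y"
    using h homD[OF kl] by (auto simp: is_kernel_def Hom_def)
  have "h \<odot> (k \<odot> e) = (h \<odot> (k \<odot> l)) \<odot> e'"
    using cmp_assoc[OF e'(1) kl hY] cmp_assoc[OF e'(1) lB kB] e'(2) by simp
  also have "\<dots> = Zero C A Y"
    using kernel_cmp[OF h kl hY] cmp_zero_left[OF e'(1) hom_objs(2)[OF hY]] by simp
  finally obtain h' where h': "h' \<in> Hom C (Tgt C c) Y" "h' \<odot> c = h"
    using cokernel_ex1[OF c cD ke hY] by blast
  have "h \<odot> k = Zero C B Y"
    using cmp_assoc[OF kB cD h'(1)] h'(2) kernel_cmp[OF k kB cD]
      cmp_zero_right[OF h'(1) hom_objs(1)[OF kB]] by simp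
  then obtain u where u: "u \<in> Hom C B E" "(k \<odot> l) \<odot> u = k"
    using kernel_ex1[OF h kl hY kB] by blast
  have "l \<odot> u = Idt C B"
    by (rule monicD[OF kernel_monic[OF k] kB cmp_hom[OF u(1) lB] idt_hom[OF hom_objs(1)[OF kB]]])
      (use cmp_assoc[OF u(1) lB kB] u(2) cmp_idt_right[OF kB] in simp)
  then have "x = (x \<odot> l) \<odot> u"
    using cmp_assoc[OF u(1) lB x] cmp_idt_right[OF x] by simp
  then show "x = Zero C B X"
    using kernel_cmp[OF l lB x] cmp_zero_left[OF u(1) hom_objs(2)[OF x]] by simp
qed

lemma exact_atI:
  assumes "is_cokernel C c f" "is_kernel C k c" "is_kernel C k g"
  shows "exact_at C f g"
proof -
  have "f \<in> Arr C" "g \<in> Arr C" "Tgt C f = Src C g"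
    using assms unfolding is_cokernel_def is_kernel_def by simp_all
  then show ?thesis
    unfolding exact_at_def using assms by blast
qed

section \<open>Exactness at the ends of a sequence and next to zero objects\<close>

lemma monic_kernel_zero_obj:
  assumes f: "f \<in> Hom C A B" and "monic C f"
  shows "is_kernel C (Zero C (zero_obj C) A) f"
proof -
  have A: "A \<in> Obj C"
    using hom_objs(1)[OF f] .
  have z: "Zero C (zero_obj C) A \<in> Hom C (zero_obj C) A"
    using A by auto
  show ?thesis
  proof (rule is_kernelI[OF z f])
    show "f \<odot> Zero C (zero_obj C) A = Zero C (zero_obj C) B"
      using cmp_zero_right[OF f] by simp
    show "monic C (Zero C (zero_obj C) A)"
      by (rule monicI[OF z]) (rule hom_zero_obj_unique(1))
  next
    fix X x assume x: "x \<in> Hom C X A" "f \<odot> x = Zero C X B"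
    have X: "X \<in> Obj C"
      using hom_objs(1)[OF x(1)] .
    have "x = Zero C X A"
      by (rule monicD[OF assms(2) f x(1) zero_hom[OF X A]]) (simp add: x(2) cmp_zero_right[OF f X])
    then show "\<exists>z \<in> Hom C X (zero_obj C). Zero C (zero_obj C) A \<odot> z = x"
      using zero_hom[OF X zero_obj_Obj] cmp_zero_left A by blast
  qed
qed

lemma epic_cokernel_zero_obj:
  assumes f: "f \<in> Hom C A B" and "epic C f"
  shows "is_cokernel C (Zero C B (zero_obj C)) f"
proof -
  have B: "B \<in> Obj C"
    using hom_objs(2)[OF f] .
  have z: "Zero C B (zero_obj C) \<in> Hom C B (zero_obj C)"
    using B by auto
  show ?thesis
  proof (rule is_cokernelI[OF z f])
    show "Zero C B (zero_obj C) \<odot> f = Zero C A (zero_obj C)"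
      using cmp_zero_left[OF f] by simp
    show "epic C (Zero C B (zero_obj C))"
      by (rule epicI[OF z]) (rule hom_zero_obj_unique(2))
  next
    fix X x assume x: "x \<in> Hom C B X" "x \<odot> f = Zero C A X"
    have X: "X \<in> Obj C"
      using hom_objs(2)[OF x(1)] .
    have "x = Zero C B X"
      by (rule epicD[OF assms(2) f x(1) zero_hom[OF B X]]) (simp add: x(2) cmp_zero_left[OF f X])
    then show "\<exists>u \<in> Hom C (zero_obj C) X. u \<odot> Zero C B (zero_obj C) = x"
      using zero_hom[OF zero_obj_Obj X] cmp_zero_right B by blast
  qed
qed

text \<open>The identity is a cokernel of the zero arrow into \<open>A\<close>, so the image of that
  arrow is the zero subobject, which is the kernel of a monic \<open>f\<close>.\<close>

lemma exact_at_monic: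
  assumes f: "f \<in> Hom C A B" and "monic C f"
  shows "exact_at C (Zero C (zero_obj C) A) f"
proof (rule exact_atI[OF _ _ monic_kernel_zero_obj[OF assms]])
  have A: "A \<in> Obj C"
    using hom_objs(1)[OF f] .
  show "is_cokernel C (Idt C A) (Zero C (zero_obj C) A)"
    by (rule idt_cokernel_zero[OF zero_obj_Obj A])
  show "is_kernel C (Zero C (zero_obj C) A) (Idt C A)"
    by (rule monic_kernel_zero_obj[OF idt_hom[OF A] kernel_monic[OF idt_kernel_zero[OF A A]]])
qed

lemma exact_at_epic:
  assumes f: "f \<in> Hom C A B" and "epic C f"
  shows "exact_at C f (Zero C B (zero_obj C))"
  by (rule exact_atI[OF epic_cokernel_zero_obj[OF assms]])
    (rule idt_kernel_zero[OF hom_objs(2)[OF f] zero_obj_Obj])+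

lemma exact_at_zero_obj:
  assumes "A \<in> Obj C" "B \<in> Obj C"
  shows "exact_at C (Zero C A (zero_obj C)) (Zero C (zero_obj C) B)"
proof -
  have z: "Zero C A (zero_obj C) \<in> Hom C A (zero_obj C)"
    using assms by auto
  have "epic C (Zero C A (zero_obj C))"
    by (rule epicI[OF z]) (rule hom_zero_obj_unique(2))
  from epic_cokernel_zero_obj[OF z this] show ?thesis
    by (rule exact_atI) (rule idt_kernel_zero[OF zero_obj_Obj zero_obj_Obj]
        idt_kernel_zero[OF zero_obj_Obj assms(2)])+
qed

text \<open>The identity of \<open>B\<close> is a kernel of the zero arrow, hence by exactness also
  of the cokernel \<open>c\<close> of \<open>q\<close>, and so \<open>c = 0\<close>. Every arrow
  that kills \<open>q\<close> factors through \<open>c\<close>.\<close>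

lemma exact_at_epicD:
  assumes q: "q \<in> Hom C A B" and D: "D \<in> Obj C" and ex: "exact_at C q (Zero C B D)"
  shows "epic C q"
proof (rule epicI_zero[OF q])
  have B: "B \<in> Obj C"
    using hom_objs(2)[OF q] .
  obtain c k where c: "is_cokernel C c q" and k: "is_kernel C k c" "is_kernel C k (Zero C B D)"
    using ex unfolding exact_at_def by blast
  have cB: "c \<in> Hom C B (Tgt C c)"
    using cokernel_hom[OF c q] .
  have "is_kernel C (Idt C B) c"
    by (rule kernel_transfer[OF k idt_kernel_zero[OF B D] zero_hom[OF B D]])
  then have c0: "c = Zero C B (Tgt C c)"
    using kernel_cmp[OF _ idt_hom[OF B] cB] cmp_idt_right[OF cB] by simp
  fix X x assume x: "x \<in> Hom C B X" "x \<odot> q = Zero C A X"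
  obtain u where u: "u \<in> Hom C (Tgt C c) X" "u \<odot> c = x"
    using cokernel_ex1[OF c cB q x] by blast
  then show "x = Zero C B X"
    using c0 cmp_zero_right[OF u(1) B] by simp
qed

lemma exact_at_cmp:
  assumes d: "d \<in> Hom C A B" and q: "q \<in> Hom C B D" and ex: "exact_at C d q"
  shows "q \<odot> d = Zero C A D"
proof -
  obtain c k where c: "is_cokernel C c d" and k: "is_kernel C k c" "is_kernel C k q"
    using ex unfolding exact_at_def by blast
  have cB: "c \<in> Hom C B (Tgt C c)" and kB: "k \<in> Hom C (Src C k) B"
    using cokernel_hom[OF c d] kernel_hom[OF k(2) q] .
  obtain z where z: "z \<in> Hom C A (Src C k)" "k \<odot> z = d"
    using kernel_ex1[OF k(1) kB cB d cokernel_cmp[OF c cB d]] by blast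
  then show ?thesis
    using cmp_assoc[OF z(1) kB q] kernel_cmp[OF k(2) kB q]
      cmp_zero_left[OF z(1) hom_objs(2)[OF q]] by simp
qed

text \<open>An arrow \<open>x\<close> with \<open>x \<odot> d = 0\<close> factors through the
  cokernel \<open>c\<close> of \<open>d\<close>, so it kills the common kernel \<open>k\<close> of
  \<open>c\<close> and \<open>q\<close>. The epic \<open>q\<close> is a cokernel of its kernel
  \<open>k\<close>, and \<open>x\<close> factors through it.\<close>

lemma exact_at_cokernel:
  assumes d: "d \<in> Hom C A B" and q: "q \<in> Hom C B D" and ex: "exact_at C d q" and "epic C q"
  shows "is_cokernel C q d"
proof (rule is_cokernelI[OF q d exact_at_cmp[OF d q ex] _ assms(4)])
  obtain c k where c: "is_cokernel C c d" and k: "is_kernel C k c" "is_kernel C k q"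
    using ex unfolding exact_at_def by blast
  have cB: "c \<in> Hom C B (Tgt C c)" and kB: "k \<in> Hom C (Src C k) B"
    using cokernel_hom[OF c d] kernel_hom[OF k(2) q] .
  fix X x assume x: "x \<in> Hom C B X" "x \<odot> d = Zero C A X"
  obtain u where u: "u \<in> Hom C (Tgt C c) X" "u \<odot> c = x"
    using cokernel_ex1[OF c cB d x] by blast
  have "x \<odot> k = Zero C (Src C k) X"
    using cmp_assoc[OF kB cB u(1)] u(2) kernel_cmp[OF k(1) kB cB]
      cmp_zero_right[OF u(1) hom_objs(1)[OF kB]] by simp
  then show "\<exists>u \<in> Hom C D X. u \<odot> q = x"
    using cokernel_ex1[OF epic_cokernel_kernel[OF assms(4) k(2)] q kB x(1)] by blast
qed

end

section \<open>Cohomology of complexes\<close>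

context preadditive_category
begin

lemma complexesD:
  assumes "X \<in> complexes C"
  shows "ob X n \<in> Obj C" "df X n \<in> Hom C (ob X n) (ob X (n + 1))"
    and "df X (n - 1) \<in> Hom C (ob X (n - 1)) (ob X n)"
    and "df X n \<odot> df X (n - 1) = Zero C (ob X (n - 1)) (ob X (n + 1))"
proof -
  have X: "ob X k \<in> Obj C" "df X k \<in> Hom C (ob X k) (ob X (k + 1))"
    "df X (k + 1) \<odot> df X k = Zero C (ob X k) (ob X (k + 2))" for k
    using assms by (auto simp: complexes_def)
  show "ob X n \<in> Obj C" "df X n \<in> Hom C (ob X n) (ob X (n + 1))"
    using X by auto
  show "df X (n - 1) \<in> Hom C (ob X (n - 1)) (ob X n)"
    using X(2)[of "n - 1"] by simp
  have eqs: "n - 1 + 1 = n" "n - 1 + 2 = n + 1"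
    by simp_all
  show "df X n \<odot> df X (n - 1) = Zero C (ob X (n - 1)) (ob X (n + 1))"
    using X(3)[of "n - 1"] unfolding eqs .
qed

lemma chain_mapsD:
  assumes "f \<in> chain_maps C X Y"
  shows "f n \<in> Hom C (ob X n) (ob Y n)"
    and "df Y n \<odot> f n = f (n + 1) \<odot> df X n"
    and "df Y (n - 1) \<odot> f (n - 1) = f n \<odot> df X (n - 1)"
proof -
  have f: "f k \<in> Hom C (ob X k) (ob Y k)" "df Y k \<odot> f k = f (k + 1) \<odot> df X k" for k
    using assms by (auto simp: chain_maps_def)
  then show "f n \<in> Hom C (ob X n) (ob Y n)" "df Y n \<odot> f n = f (n + 1) \<odot> df X n"
    by auto
  show "df Y (n - 1) \<odot> f (n - 1) = f n \<odot> df X (n - 1)"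
    using f(2)[of "n - 1"] by simp
qed

end

context abelian_category
begin

definition cocycles :: "('o, 'm) cx \<Rightarrow> int \<Rightarrow> 'o" where
  "cocycles X n = Src C (ker C (df X n))"

definition cohomology :: "('o, 'm) cx \<Rightarrow> int \<Rightarrow> 'o" where
  "cohomology X n = Tgt C (coh_proj C X n)"

abbreviation corestricted_df :: "('o, 'm) cx \<Rightarrow> int \<Rightarrow> 'm" where
  "corestricted_df X n \<equiv> lift C (ker C (df X n)) (df X (n - 1))"

lemma cocycles_kernel:
  assumes "X \<in> complexes C"
  shows "is_kernel C (ker C (df X n)) (df X n)"
    and "ker C (df X n) \<in> Hom C (cocycles X n) (ob X n)"
proof -
  show k: "is_kernel C (ker C (df X n)) (df X n)"
    using ker_is_kernel homD(1)[OF complexesD(2)[OF assms]] .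
  show "ker C (df X n) \<in> Hom C (cocycles X n) (ob X n)"
    using kernel_hom[OF k complexesD(2)[OF assms]] by (simp add: cocycles_def)
qed

lemma corestricted_df:
  assumes "X \<in> complexes C"
  shows "corestricted_df X n \<in> Hom C (ob X (n - 1)) (cocycles X n)"
    and "ker C (df X n) \<odot> corestricted_df X n = df X (n - 1)"
  using lift_props[OF cocycles_kernel[OF assms] complexesD(2-4)[OF assms]] .

lemma coh_proj_cokernel:
  assumes "X \<in> complexes C"
  shows "is_cokernel C (coh_proj C X n) (corestricted_df X n)"
    and "coh_proj C X n \<in> Hom C (cocycles X n) (cohomology X n)"
proof -
  show p: "is_cokernel C (coh_proj C X n) (corestricted_df X n)"
    unfolding coh_proj_def using coker_is_cokernel homD(1)[OF corestricted_df(1)[OF assms]] .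
  show "coh_proj C X n \<in> Hom C (cocycles X n) (cohomology X n)"
    using cokernel_hom[OF p corestricted_df(1)[OF assms]] by (simp add: cohomology_def)
qed

definition cocycle_map where
  "cocycle_map X Y f n = lift C (ker C (df Y n)) (f n \<odot> ker C (df X n))"

text \<open>Cocycles go to cocycles and coboundaries to coboundaries. The last clause is the
  condition under which the description operator in \<open>coh_map\<close> denotes the arrow given
  by the universal property of \<open>coh_proj\<close>.\<close>

lemma cocycle_map:
  assumes X: "X \<in> complexes C" and Y: "Y \<in> complexes C" and f: "f \<in> chain_maps C X Y"
  shows "cocycle_map X Y f n \<in> Hom C (cocycles X n) (cocycles Y n)"
    and "ker C (df Y n) \<odot> cocycle_map X Y f n = f n \<odot> ker C (df X n)"
    and "(coh_proj C Y n \<odot> cocycle_map X Y f n) \<odot> corestricted_df X n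
      = Zero C (ob X (n - 1)) (cohomology Y n)"
proof -
  note kX = cocycles_kernel[OF X, of n] and kY = cocycles_kernel[OF Y, of n]
  note dX = complexesD[OF X] and dY = complexesD[OF Y]
  note eX = corestricted_df[OF X, of n] and eY = corestricted_df[OF Y, of n]
  note pY = coh_proj_cokernel[OF Y, of n]
  have fk: "f n \<odot> ker C (df X n) \<in> Hom C (cocycles X n) (ob Y n)"
    using cmp_hom[OF kX(2) chain_mapsD(1)[OF f]] .
  have "df Y n \<odot> (f n \<odot> ker C (df X n)) = f (n + 1) \<odot> (df X n \<odot> ker C (df X n))"
    using cmp_assoc[OF kX(2) chain_mapsD(1)[OF f] dY(2)] chain_mapsD(2)[OF f, of n]
      cmp_assoc[OF kX(2) dX(2) chain_mapsD(1)[OF f]] by simp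
  also have "\<dots> = Zero C (cocycles X n) (ob Y (n + 1))"
    using kernel_cmp[OF kX dX(2)] cmp_zero_right[OF chain_mapsD(1)[OF f] hom_objs(1)[OF kX(2)]]
    by simp
  finally have 0: "df Y n \<odot> (f n \<odot> ker C (df X n)) = Zero C (cocycles X n) (ob Y (n + 1))" .
  note z = lift_props[OF kY dY(2) fk 0, folded cocycle_map_def]
  show "cocycle_map X Y f n \<in> Hom C (cocycles X n) (cocycles Y n)"
    "ker C (df Y n) \<odot> cocycle_map X Y f n = f n \<odot> ker C (df X n)"
    using z .
  have fp: "f (n - 1) \<in> Hom C (ob X (n - 1)) (ob Y (n - 1))"
    using chain_mapsD(1)[OF f] .
  \<comment> \<open>Tested after the monic inclusion of the cocycles, this becomes the chain map
    equation from degree \<open>n - 1\<close>.\<close>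
  have "cocycle_map X Y f n \<odot> corestricted_df X n = corestricted_df Y n \<odot> f (n - 1)"
  proof (rule monicD[OF kernel_monic[OF kY(1)] kY(2) cmp_hom[OF eX(1) z(1)] cmp_hom[OF fp eY(1)]])
    show "ker C (df Y n) \<odot> (cocycle_map X Y f n \<odot> corestricted_df X n)
      = ker C (df Y n) \<odot> (corestricted_df Y n \<odot> f (n - 1))"
      using cmp_assoc[OF eX(1) z(1) kY(2)] z(2) cmp_assoc[OF eX(1) kX(2) chain_mapsD(1)[OF f]] eX(2)
        cmp_assoc[OF fp eY(1) kY(2)] eY(2) chain_mapsD(3)[OF f, of n] by simp
  qed
  then have "(coh_proj C Y n \<odot> cocycle_map X Y f n) \<odot> corestricted_df X n
      = (coh_proj C Y n \<odot> corestricted_df Y n) \<odot> f (n - 1)"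
    using cmp_assoc[OF eX(1) z(1) pY(2)] cmp_assoc[OF fp eY(1) pY(2)] by simp
  then show "(coh_proj C Y n \<odot> cocycle_map X Y f n) \<odot> corestricted_df X n
      = Zero C (ob X (n - 1)) (cohomology Y n)"
    using cokernel_cmp[OF pY eY(1)] cmp_zero_left[OF fp hom_objs(2)[OF pY(2)]] by simp
qed

lemma coh_map_hom:
  assumes X: "X \<in> complexes C" and Y: "Y \<in> complexes C" and f: "f \<in> chain_maps C X Y"
  shows "coh_map C X Y f n \<in> Hom C (cohomology X n) (cohomology Y n)"
  unfolding coh_map_def
  using colift_props(1)[OF coh_proj_cokernel[OF X] corestricted_df(1)[OF X]
      cmp_hom[OF cocycle_map(1)[OF assms] coh_proj_cokernel(2)[OF Y]] cocycle_map(3)[OF assms]]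
  by (simp add: cocycle_map_def)

text \<open>A vanishing object is expressed by the equality of its identity with zero. By exactness
  the cocycles are the image of the incoming differential, whose corestriction is thus epic; its
  cokernel \<open>coh_proj\<close> is then both zero and epic.\<close>

lemma cohomology_exact:
  assumes X: "X \<in> complexes C" and ex: "exact_at C (df X (n - 1)) (df X n)"
  shows "Idt C (cohomology X n) = Zero C (cohomology X n) (cohomology X n)"
proof -
  note kX = cocycles_kernel[OF X, of n] and eX = corestricted_df[OF X, of n]
  note pX = coh_proj_cokernel[OF X, of n]
  have Z: "cocycles X n \<in> Obj C" and H: "cohomology X n \<in> Obj C"
    using hom_objs[OF pX(2)] .
  obtain c k where c: "is_cokernel C c (df X (n - 1))" and k: "is_kernel C k c" "is_kernel C k (df X n)"
    using ex unfolding exact_at_def by blast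
  have "is_kernel C (ker C (df X n)) c"
    by (rule kernel_transfer[OF k kX(1) complexesD(2)[OF X]])
  then have "epic C (corestricted_df X n)"
    using image_map_epic[OF _ _ eX(1) kX(2)] c eX(2) by simp
  then have "coh_proj C X n = Zero C (cocycles X n) (cohomology X n)"
    by (rule epicD[OF _ eX(1) pX(2) zero_hom[OF Z H]])
      (simp add: cokernel_cmp[OF pX eX(1)] cmp_zero_left[OF eX(1) H])
  then show ?thesis
    by (intro epicD[OF cokernel_epic[OF pX(1)] pX(2) idt_hom[OF H] zero_hom[OF H H]])
      (use cmp_idt_left[OF pX(2)] cmp_zero_left[OF pX(2) H] in simp)
qed

lemma isomorphism_zero:
  assumes f: "f \<in> Hom C A B" and A: "Idt C A = Zero C A A" and B: "Idt C B = Zero C B B"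
  shows "isomorphism C f"
proof (rule isomorphismI[OF f])
  show "Zero C B A \<in> Hom C B A"
    using zero_hom hom_objs[OF f] by blast
  show "Zero C B A \<odot> f = Idt C A" "f \<odot> Zero C B A = Idt C B"
    using cmp_zero_left[OF f hom_objs(1)[OF f]] cmp_zero_right[OF f hom_objs(2)[OF f]] A B by auto
qed

lemma coh_map_isomorphism_exact:
  assumes X: "X \<in> complexes C" and Y: "Y \<in> complexes C" and f: "f \<in> chain_maps C X Y"
    and "exact_at C (df X (n - 1)) (df X n)" "exact_at C (df Y (n - 1)) (df Y n)"
  shows "isomorphism C (coh_map C X Y f n)"
  using isomorphism_zero[OF coh_map_hom[OF X Y f] cohomology_exact[OF X] cohomology_exact[OF Y]]
    assms(4,5) by blast

text \<open>The chosen kernel of a zero arrow is an isomorphism but need not be the identity, so its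
  inverse \<open>s\<close> is carried along explicitly.\<close>

lemma kernel_of_zero_section:
  assumes k: "is_kernel C k (Zero C A B)" and kA: "k \<in> Hom C K A" and B: "B \<in> Obj C"
  obtains s where "s \<in> Hom C A K" "k \<odot> s = Idt C A" "s \<odot> k = Idt C K"
proof -
  have A: "A \<in> Obj C"
    using hom_objs(2)[OF kA] .
  obtain s where s: "s \<in> Hom C A K" "k \<odot> s = Idt C A"
    using kernel_ex1[OF k kA zero_hom[OF A B] idt_hom[OF A]] cmp_idt_right[OF zero_hom[OF A B]]
    by blast
  have "s \<odot> k = Idt C K"
    by (rule monicD[OF kernel_monic[OF k] kA cmp_hom[OF kA s(1)] idt_hom[OF hom_objs(1)[OF kA]]])
      (use cmp_assoc[OF kA s(1) kA] s(2) cmp_idt_left[OF kA] cmp_idt_right[OF kA] in simp)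
  with s show ?thesis
    using that by blast
qed

text \<open>Up to isomorphism, the cohomology of \<open>X\<close> at \<open>n\<close> is the
  cokernel of the incoming differential and that of \<open>Y\<close> is the object itself;
  \<open>f n\<close> presents the second as the first. The proof shows that the composite defining
  \<open>coh_map\<close> is a second cokernel of the corestricted differential.\<close>

lemma coh_map_isomorphism_cokernel:
  assumes X: "X \<in> complexes C" and Y: "Y \<in> complexes C" and f: "f \<in> chain_maps C X Y"
    and dX0: "df X n = Zero C (ob X n) (ob X (n + 1))"
    and dY0: "df Y n = Zero C (ob Y n) (ob Y (n + 1))"
    and dY1: "df Y (n - 1) = Zero C (ob Y (n - 1)) (ob Y n)"
    and c: "is_cokernel C (f n) (df X (n - 1))"
  shows "isomorphism C (coh_map C X Y f n)"
proof -
  note kX = cocycles_kernel[OF X, of n] and kY = cocycles_kernel[OF Y, of n]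
  note dX = complexesD[OF X] and dY = complexesD[OF Y]
  note eX = corestricted_df[OF X, of n] and eY = corestricted_df[OF Y, of n]
  note pX = coh_proj_cokernel[OF X, of n] and pY = coh_proj_cokernel[OF Y, of n]
  note z = cocycle_map[OF X Y f, of n]
  have fn: "f n \<in> Hom C (ob X n) (ob Y n)"
    using chain_mapsD(1)[OF f] .
  obtain sX where sX: "sX \<in> Hom C (ob X n) (cocycles X n)"
    "ker C (df X n) \<odot> sX = Idt C (ob X n)" "sX \<odot> ker C (df X n) = Idt C (cocycles X n)"
    using kernel_of_zero_section[OF kX(1)[unfolded dX0] kX(2)[unfolded dX0] dX(1)] dX0 by metis
  obtain sY where sY: "sY \<in> Hom C (ob Y n) (cocycles Y n)"
    "ker C (df Y n) \<odot> sY = Idt C (ob Y n)" "sY \<odot> ker C (df Y n) = Idt C (cocycles Y n)"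
    using kernel_of_zero_section[OF kY(1)[unfolded dY0] kY(2)[unfolded dY0] dY(1)] dY0 by metis
  have ZY: "cocycles Y n \<in> Obj C"
    using hom_objs(1)[OF kY(2)] .
  have z_eq: "cocycle_map X Y f n = sY \<odot> (f n \<odot> ker C (df X n))"
    using cmp_assoc[OF z(1) kY(2) sY(1)] z(2) sY(3) cmp_idt_left[OF z(1)] by simp
  \<comment> \<open>\<open>Y\<close> has no coboundaries in degree \<open>n\<close>, so the identity
    of its cocycles descends to cohomology; this yields the left inverse \<open>t\<close> of
    \<open>coh_proj\<close>.\<close>
  have eY0: "corestricted_df Y n = Zero C (ob Y (n - 1)) (cocycles Y n)"
    by (rule monicD[OF kernel_monic[OF kY(1)] kY(2) eY(1) zero_hom[OF dY(1) ZY]])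
      (use eY(2) cmp_zero_right[OF kY(2) dY(1)] dY1 in simp)
  have "Idt C (cocycles Y n) \<odot> corestricted_df Y n = Zero C (ob Y (n - 1)) (cocycles Y n)"
    using cmp_idt_left[OF eY(1)] eY0 by simp
  then obtain t where t: "t \<in> Hom C (cohomology Y n) (cocycles Y n)"
    "t \<odot> coh_proj C Y n = Idt C (cocycles Y n)"
    using cokernel_ex1[OF pY eY(1) idt_hom[OF ZY]] by blast
  have pz: "coh_proj C Y n \<odot> cocycle_map X Y f n \<in> Hom C (cocycles X n) (cohomology Y n)"
    using cmp_hom[OF z(1) pY(2)] .
  have "is_cokernel C (coh_proj C Y n \<odot> cocycle_map X Y f n) (corestricted_df X n)"
  proof (rule is_cokernelI[OF pz eX(1) z(3)])
    have "epic C (f n \<odot> ker C (df X n))"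
      by (rule epic_cmp[OF epic_section[OF kX(2) sX(1,2)] kX(2) cokernel_epic[OF c] fn])
    then have "epic C (cocycle_map X Y f n)"
      unfolding z_eq by (rule epic_cmp[OF _ cmp_hom[OF kX(2) fn] epic_section[OF sY(1) kY(2) sY(3)] sY(1)])
    then show "epic C (coh_proj C Y n \<odot> cocycle_map X Y f n)"
      by (rule epic_cmp[OF _ z(1) cokernel_epic[OF pY(1)] pY(2)])
  next
    fix T g assume g: "g \<in> Hom C (cocycles X n) T"
      "g \<odot> corestricted_df X n = Zero C (ob X (n - 1)) T"
    have gs: "g \<odot> sX \<in> Hom C (ob X n) T"
      using cmp_hom[OF sX(1) g(1)] .
    have "sX \<odot> df X (n - 1) = corestricted_df X n"
      using cmp_assoc[OF eX(1) kX(2) sX(1)] eX(2) sX(3) cmp_idt_left[OF eX(1)] by simp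
    then have "(g \<odot> sX) \<odot> df X (n - 1) = Zero C (ob X (n - 1)) T"
      using cmp_assoc[OF dX(3) sX(1) g(1)] g(2) by simp
    then obtain u where u: "u \<in> Hom C (ob Y n) T" "u \<odot> f n = g \<odot> sX"
      using cokernel_ex1[OF c fn dX(3) gs] by blast
    \<comment> \<open>The required factor sends a class to its cocycle by \<open>t\<close>, includes
      that into \<open>ob Y n\<close>, and applies the factor \<open>u\<close> of
      \<open>g \<odot> sX\<close> through \<open>f n\<close>.\<close>
    have utp: "(u \<odot> (ker C (df Y n) \<odot> t)) \<odot> (coh_proj C Y n \<odot> cocycle_map X Y f n)
      = u \<odot> (ker C (df Y n) \<odot> cocycle_map X Y f n)"
      using cmp_assoc[OF pz cmp_hom[OF t(1) kY(2)] u(1)] cmp_assoc[OF pz t(1) kY(2)]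
        cmp_assoc[OF z(1) pY(2) t(1)] t(2) cmp_idt_left[OF z(1)] by simp
    also have "\<dots> = (g \<odot> sX) \<odot> ker C (df X n)"
      using z(2) cmp_assoc[OF kX(2) fn u(1)] u(2) by simp
    also have "\<dots> = g"
      using cmp_assoc[OF kX(2) sX(1) g(1)] sX(3) cmp_idt_right[OF g(1)] by simp
    finally show "\<exists>u \<in> Hom C (cohomology Y n) T. u \<odot> (coh_proj C Y n \<odot> cocycle_map X Y f n) = g"
      using cmp_hom[OF cmp_hom[OF t(1) kY(2)] u(1)] by blast
  qed
  then show ?thesis
    unfolding coh_map_def cocycle_map_def[symmetric]
    using colift_cokernel_iso[OF pX _ pz eX(1)] by blast
qed

end

section \<open>The homotopy category and its shift\<close>

context preadditive_category
begin

definition boundary ::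
  "('o, 'm) cx \<Rightarrow> ('o, 'm) cx \<Rightarrow> (int \<Rightarrow> 'm) \<Rightarrow> int \<Rightarrow> 'm" where
  "boundary X Y h n = Add C (df Y (n - 1) \<odot> h n) (h (n + 1) \<odot> df X n)"

definition degree_down :: "('o, 'm) cx \<Rightarrow> ('o, 'm) cx \<Rightarrow> (int \<Rightarrow> 'm) set" where
  "degree_down X Y = {h. \<forall>n. h n \<in> Hom C (ob X n) (ob Y (n - 1))}"

lemma homotopic_iff:
  "(f, g) \<in> homotopic C X Y \<longleftrightarrow> f \<in> chain_maps C X Y \<and> g \<in> chain_maps C X Y \<and>
     (\<exists>h \<in> degree_down X Y. \<forall>n. f n = Add C (g n) (boundary X Y h n))"
  by (auto simp: homotopic_def degree_down_def boundary_def)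

lemma degree_downD:
  assumes "h \<in> degree_down X Y"
  shows "h n \<in> Hom C (ob X n) (ob Y (n - 1))" "h (n + 1) \<in> Hom C (ob X (n + 1)) (ob Y n)"
proof -
  have h: "h k \<in> Hom C (ob X k) (ob Y (k - 1))" for k
    using assms by (auto simp: degree_down_def)
  show "h n \<in> Hom C (ob X n) (ob Y (n - 1))" "h (n + 1) \<in> Hom C (ob X (n + 1)) (ob Y n)"
    using h[of n] h[of "n + 1"] by simp_all
qed

context
  fixes X Y :: "('o, 'm) cx"
  assumes X: "X \<in> complexes C" and Y: "Y \<in> complexes C"
begin

lemma boundary_terms:
  assumes "h \<in> degree_down X Y"
  shows "df Y (n - 1) \<odot> h n \<in> Hom C (ob X n) (ob Y n)"
    and "h (n + 1) \<odot> df X n \<in> Hom C (ob X n) (ob Y n)"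
  using cmp_hom[OF degree_downD(1)[OF assms] complexesD(3)[OF Y]]
    cmp_hom[OF complexesD(2)[OF X] degree_downD(2)[OF assms]] .

lemma boundary_hom:
  assumes "h \<in> degree_down X Y"
  shows "boundary X Y h n \<in> Hom C (ob X n) (ob Y n)"
  unfolding boundary_def using add_hom[OF boundary_terms[OF assms]] .

lemma zero_degree_down: "(\<lambda>n. Zero C (ob X n) (ob Y (n - 1))) \<in> degree_down X Y"
  using zero_hom complexesD(1)[OF X] complexesD(1)[OF Y] by (simp add: degree_down_def)

lemma boundary_zero:
  "boundary X Y (\<lambda>n. Zero C (ob X n) (ob Y (n - 1))) n = Zero C (ob X n) (ob Y n)"
  using cmp_zero_right[OF complexesD(3)[OF Y] complexesD(1)[OF X]]
    cmp_zero_left[OF complexesD(2)[OF X] complexesD(1)[OF Y]]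
    add_zero[OF zero_hom[OF complexesD(1)[OF X] complexesD(1)[OF Y]]]
  by (simp add: boundary_def)

lemma add_degree_down:
  assumes "h \<in> degree_down X Y" "k \<in> degree_down X Y"
  shows "(\<lambda>n. Add C (h n) (k n)) \<in> degree_down X Y"
  using add_hom assms by (simp add: degree_down_def)

lemma boundary_add:
  assumes h: "h \<in> degree_down X Y" and k: "k \<in> degree_down X Y"
  shows "boundary X Y (\<lambda>n. Add C (h n) (k n)) n = Add C (boundary X Y h n) (boundary X Y k n)"
proof -
  note H = boundary_terms[OF h, of n] and K = boundary_terms[OF k, of n]
  have "boundary X Y (\<lambda>n. Add C (h n) (k n)) n
      = Add C (Add C (df Y (n - 1) \<odot> h n) (df Y (n - 1) \<odot> k n))
          (Add C (h (n + 1) \<odot> df X n) (k (n + 1) \<odot> df X n))"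
    unfolding boundary_def
    using cmp_add_right[OF degree_downD(1)[OF h] degree_downD(1)[OF k] complexesD(3)[OF Y]]
      cmp_add_left[OF complexesD(2)[OF X] degree_downD(2)[OF h] degree_downD(2)[OF k]] by simp
  also have "\<dots> = Add C (boundary X Y h n) (boundary X Y k n)"
    unfolding boundary_def
    using add_assoc[OF H(1) K(1) add_hom[OF H(2) K(2)]] add_left_comm[OF K(1) H(2) K(2)]
      add_assoc[OF H(1) H(2) add_hom[OF K(1) K(2)]] by simp
  finally show ?thesis .
qed

lemma homotopic_refl:
  assumes "f \<in> chain_maps C X Y"
  shows "(f, f) \<in> homotopic C X Y"
proof -
  have "f n = Add C (f n) (boundary X Y (\<lambda>n. Zero C (ob X n) (ob Y (n - 1))) n)" for n
    using add_zero[OF chain_mapsD(1)[OF assms]] boundary_zero by simp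
  then show ?thesis
    unfolding homotopic_iff using assms zero_degree_down by blast
qed

lemma homotopic_trans:
  assumes "(f, g) \<in> homotopic C X Y" "(g, e) \<in> homotopic C X Y"
  shows "(f, e) \<in> homotopic C X Y"
proof -
  obtain h where f: "f \<in> chain_maps C X Y"
    and h: "h \<in> degree_down X Y" "\<And>n. f n = Add C (g n) (boundary X Y h n)"
    using assms(1) unfolding homotopic_iff by blast
  obtain k where e: "e \<in> chain_maps C X Y"
    and k: "k \<in> degree_down X Y" "\<And>n. g n = Add C (e n) (boundary X Y k n)"
    using assms(2) unfolding homotopic_iff by blast
  have "f n = Add C (e n) (boundary X Y (\<lambda>n. Add C (k n) (h n)) n)" for n
    using add_assoc[OF chain_mapsD(1)[OF e] boundary_hom[OF k(1)] boundary_hom[OF h(1)]]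
      boundary_add[OF k(1) h(1)] h(2) k(2) by simp
  then show ?thesis
    unfolding homotopic_iff using f e add_degree_down[OF k(1) h(1)] by blast
qed

end

lemma cmp_chain_maps:
  assumes X: "X \<in> complexes C" and Y: "Y \<in> complexes C" and Z: "Z \<in> complexes C"
    and f: "f \<in> chain_maps C X Y" and g: "g \<in> chain_maps C Y Z"
  shows "(\<lambda>n. g n \<odot> f n) \<in> chain_maps C X Z"
proof -
  have "df Z n \<odot> (g n \<odot> f n) = (g (n + 1) \<odot> f (n + 1)) \<odot> df X n" for n
    using cmp_assoc[OF chain_mapsD(1)[OF f] chain_mapsD(1)[OF g] complexesD(2)[OF Z], of n]
      cmp_assoc[OF chain_mapsD(1)[OF f] complexesD(2)[OF Y] chain_mapsD(1)[OF g], of n]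
      cmp_assoc[OF complexesD(2)[OF X] chain_mapsD(1)[OF f] chain_mapsD(1)[OF g], of n]
      chain_mapsD(2)[OF f, of n] chain_mapsD(2)[OF g, of n] by simp
  then show ?thesis
    using cmp_hom[OF chain_mapsD(1)[OF f] chain_mapsD(1)[OF g]] by (simp add: chain_maps_def)
qed

lemma homotopic_cmp_right:
  assumes X: "X \<in> complexes C" and Y: "Y \<in> complexes C" and Z: "Z \<in> complexes C"
    and fg: "(f, g) \<in> homotopic C X Y" and e: "e \<in> chain_maps C Y Z"
  shows "((\<lambda>n. e n \<odot> f n), (\<lambda>n. e n \<odot> g n)) \<in> homotopic C X Z"
proof -
  obtain h where f: "f \<in> chain_maps C X Y" and g: "g \<in> chain_maps C X Y"
    and h: "h \<in> degree_down X Y" "\<And>n. f n = Add C (g n) (boundary X Y h n)"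
    using fg unfolding homotopic_iff by blast
  \<comment> \<open>As \<open>e\<close> commutes with the differentials,
    \<open>e (d h + h d) = d (e h) + (e h) d\<close>; the index is \<open>n - 1\<close> because
    \<open>h\<close> lowers the degree.\<close>
  define k where "k n = e (n - 1) \<odot> h n" for n
  have k: "k \<in> degree_down X Z"
    using cmp_hom[OF degree_downD(1)[OF h(1)] chain_mapsD(1)[OF e]]
    by (simp add: degree_down_def k_def)
  have "e n \<odot> boundary X Y h n = boundary X Z k n" for n
  proof -
    have "e n \<odot> boundary X Y h n
        = Add C (e n \<odot> (df Y (n - 1) \<odot> h n)) (e n \<odot> (h (n + 1) \<odot> df X n))"
      unfolding boundary_def by (rule cmp_add_right[OF boundary_terms[OF X Y h(1)] chain_mapsD(1)[OF e]])
    also have "e n \<odot> (df Y (n - 1) \<odot> h n) = df Z (n - 1) \<odot> k n"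
      using cmp_assoc[OF degree_downD(1)[OF h(1)] complexesD(3)[OF Y] chain_mapsD(1)[OF e], of n]
        cmp_assoc[OF degree_downD(1)[OF h(1)] chain_mapsD(1)[OF e] complexesD(3)[OF Z], of n]
        chain_mapsD(3)[OF e, of n] by (simp add: k_def)
    also have "e n \<odot> (h (n + 1) \<odot> df X n) = k (n + 1) \<odot> df X n"
      using cmp_assoc[OF complexesD(2)[OF X] degree_downD(2)[OF h(1)] chain_mapsD(1)[OF e], of n]
      by (simp add: k_def)
    finally show ?thesis
      by (simp add: boundary_def)
  qed
  then have "e n \<odot> f n = Add C (e n \<odot> g n) (boundary X Z k n)" for n
    using cmp_add_right[OF chain_mapsD(1)[OF g] boundary_hom[OF X Y h(1)] chain_mapsD(1)[OF e], of n]
      h(2)[of n] by simp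
  then show ?thesis
    unfolding homotopic_iff using k cmp_chain_maps[OF X Y Z _ e] f g by blast
qed

lemma homotopic_cmp_left:
  assumes X: "X \<in> complexes C" and Y: "Y \<in> complexes C" and Z: "Z \<in> complexes C"
    and fg: "(f, g) \<in> homotopic C Y Z" and e: "e \<in> chain_maps C X Y"
  shows "((\<lambda>n. f n \<odot> e n), (\<lambda>n. g n \<odot> e n)) \<in> homotopic C X Z"
proof -
  obtain h where f: "f \<in> chain_maps C Y Z" and g: "g \<in> chain_maps C Y Z"
    and h: "h \<in> degree_down Y Z" "\<And>n. f n = Add C (g n) (boundary Y Z h n)"
    using fg unfolding homotopic_iff by blast
  define k where "k n = h n \<odot> e n" for n
  have k: "k \<in> degree_down X Z"
    using cmp_hom[OF chain_mapsD(1)[OF e] degree_downD(1)[OF h(1)]]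
    by (simp add: degree_down_def k_def)
  have "boundary Y Z h n \<odot> e n = boundary X Z k n" for n
  proof -
    have "boundary Y Z h n \<odot> e n
        = Add C ((df Z (n - 1) \<odot> h n) \<odot> e n) ((h (n + 1) \<odot> df Y n) \<odot> e n)"
      unfolding boundary_def by (rule cmp_add_left[OF chain_mapsD(1)[OF e] boundary_terms[OF Y Z h(1)]])
    also have "(df Z (n - 1) \<odot> h n) \<odot> e n = df Z (n - 1) \<odot> k n"
      unfolding k_def
      by (rule cmp_assoc[OF chain_mapsD(1)[OF e] degree_downD(1)[OF h(1)] complexesD(3)[OF Z]])
    also have "(h (n + 1) \<odot> df Y n) \<odot> e n = k (n + 1) \<odot> df X n"
      using cmp_assoc[OF chain_mapsD(1)[OF e] complexesD(2)[OF Y] degree_downD(2)[OF h(1)], of n]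
        cmp_assoc[OF complexesD(2)[OF X] chain_mapsD(1)[OF e] degree_downD(2)[OF h(1)], of n]
        chain_mapsD(2)[OF e, of n] by (simp add: k_def)
    finally show ?thesis
      by (simp add: boundary_def)
  qed
  then have "f n \<odot> e n = Add C (g n \<odot> e n) (boundary X Z k n)" for n
    using cmp_add_left[OF chain_mapsD(1)[OF e] chain_mapsD(1)[OF g] boundary_hom[OF Y Z h(1)], of n]
      h(2)[of n] by simp
  then show ?thesis
    unfolding homotopic_iff using k cmp_chain_maps[OF X Y Z e] f g by blast
qed

lemma homotopy_class_hom:
  assumes "X \<in> complexes C" "Y \<in> complexes C" "f \<in> chain_maps C X Y"
  shows "homotopy_class C X Y f \<in> Hom (homotopy_cat C) X Y"
  using assms by (auto simp: Hom_def homotopy_cat_def homotopy_class_def)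

lemma homotopy_cat_homE:
  assumes "a \<in> Hom (homotopy_cat C) X Y"
  obtains f where "X \<in> complexes C" "Y \<in> complexes C" "f \<in> chain_maps C X Y"
    "a = homotopy_class C X Y f"
  using assms by (auto simp: Hom_def homotopy_cat_def homotopy_class_def)

text \<open>Composition in \<open>homotopy_cat\<close> composes all representatives and then closes
  under homotopy. The set of these composites contains \<open>g \<odot> f\<close>, and every member
  is homotopic to it, so reflexivity and transitivity identify the closure with one class.\<close>

lemma homotopy_class_cmp:
  assumes X: "X \<in> complexes C" and Y: "Y \<in> complexes C" and Z: "Z \<in> complexes C"
    and f: "f \<in> chain_maps C X Y" and g: "g \<in> chain_maps C Y Z"
  shows "homotopy_class C Y Z g \<odot>\<^bsub>homotopy_cat C\<^esub> homotopy_class C X Y f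
    = homotopy_class C X Z (\<lambda>n. g n \<odot> f n)"
proof -
  let ?S = "{\<lambda>n. g' n \<odot> f' n | f' g'. f' \<in> homotopic C X Y `` {f} \<and> g' \<in> homotopic C Y Z `` {g}}"
  have "((\<lambda>n. g n \<odot> f n), (\<lambda>n. g' n \<odot> f' n)) \<in> homotopic C X Z"
    if f': "(f, f') \<in> homotopic C X Y" and g': "(g, g') \<in> homotopic C Y Z" for f' g'
  proof -
    have "f' \<in> chain_maps C X Y"
      using f' by (simp add: homotopic_iff)
    then show ?thesis
      using homotopic_trans[OF X Z homotopic_cmp_right[OF X Y Z f' g] homotopic_cmp_left[OF X Y Z g']]
      by blast
  qed
  then have sub: "?S \<subseteq> homotopic C X Z `` {\<lambda>n. g n \<odot> f n}"
    by blast
  have "(\<lambda>n. g n \<odot> f n) \<in> ?S"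
    using homotopic_refl[OF X Y f] homotopic_refl[OF Y Z g] by blast
  then have "homotopic C X Z `` ?S = homotopic C X Z `` {\<lambda>n. g n \<odot> f n}"
    using sub homotopic_trans[OF X Z] by blast
  then show ?thesis
    by (simp add: homotopy_cat_def homotopy_class_def)
qed

lemma homotopy_cat_Obj [simp]: "Obj (homotopy_cat C) = complexes C"
  by (simp add: homotopy_cat_def)

lemma homotopy_cat_Idt: "Idt (homotopy_cat C) X = homotopy_class C X X (\<lambda>n. Idt C (ob X n))"
  by (simp add: homotopy_cat_def)

lemma homotopy_cat_cmp_hom:
  assumes "a \<in> Hom (homotopy_cat C) X Y" "b \<in> Hom (homotopy_cat C) Y Z"
  shows "b \<odot>\<^bsub>homotopy_cat C\<^esub> a \<in> Hom (homotopy_cat C) X Z"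
  using assms
  by (elim homotopy_cat_homE) (simp add: homotopy_class_cmp homotopy_class_hom cmp_chain_maps)

section \<open>The shift as a functor on the homotopy category that preserves
  quasi-isomorphisms\<close>

lemma shift_complexes:
  assumes "X \<in> complexes C"
  shows "shift i X \<in> complexes C"
proof -
  have "ob X k \<in> Obj C" "df X k \<in> Hom C (ob X k) (ob X (k + 1))"
    "df X (k + 1) \<odot> df X k = Zero C (ob X k) (ob X (k + 2))" for k
    using assms by (auto simp: complexes_def)
  note X = this[of "n + i" for n]
  have "n + i + 1 = n + 1 + i" "n + i + 2 = n + 2 + i" for n :: int
    by simp_all
  from X[unfolded this] show ?thesis
    by (simp add: complexes_def shift_def)
qed

lemma shift_chain_maps:
  assumes "f \<in> chain_maps C X Y"
  shows "(\<lambda>n. f (n + i)) \<in> chain_maps C (shift i X) (shift i Y)"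
proof -
  have "f k \<in> Hom C (ob X k) (ob Y k)" "df Y k \<odot> f k = f (k + 1) \<odot> df X k" for k
    using assms by (auto simp: chain_maps_def)
  note f = this[of "n + i" for n]
  have "n + i + 1 = n + 1 + i" for n :: int
    by simp
  from f[unfolded this] show ?thesis
    by (simp add: chain_maps_def shift_def)
qed

lemma shift_homotopic:
  assumes "(f, g) \<in> homotopic C X Y"
  shows "((\<lambda>n. f (n + i)), (\<lambda>n. g (n + i))) \<in> homotopic C (shift i X) (shift i Y)"
proof -
  obtain h where f: "f \<in> chain_maps C X Y" and g: "g \<in> chain_maps C X Y"
    and h: "h \<in> degree_down X Y" "\<And>n. f n = Add C (g n) (boundary X Y h n)"
    using assms unfolding homotopic_iff by blast
  have idx: "n + i - 1 = n - 1 + i" "n + i + 1 = n + 1 + i" for n :: int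
    by simp_all
  have "h (n + i) \<in> Hom C (ob X (n + i)) (ob Y (n - 1 + i))" for n
    using degree_downD(1)[OF h(1), of "n + i"] unfolding idx .
  then have "(\<lambda>n. h (n + i)) \<in> degree_down (shift i X) (shift i Y)"
    by (simp add: degree_down_def shift_def)
  moreover have "f (n + i) = Add C (g (n + i)) (boundary (shift i X) (shift i Y) (\<lambda>n. h (n + i)) n)" for n
    using h(2)[of "n + i"] unfolding boundary_def idx by (simp add: shift_def)
  ultimately show ?thesis
    unfolding homotopic_iff using shift_chain_maps[OF f] shift_chain_maps[OF g] by blast
qed

lemma shift_shift: "shift i (shift j X) = shift (i + j) X"
  by (simp add: shift_def add.assoc)

lemma shift_0: "shift 0 X = X"
  by (simp add: shift_def)

text \<open>\<open>shift_karr\<close> moves representatives one by one without closing under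
  homotopy, so the image has to be the full class already. It is, because shifting by
  \<open>- i\<close> brings any member of the shifted class back.\<close>

lemma shift_homotopy_class:
  "shift_karr i (homotopy_class C X Y f)
    = homotopy_class C (shift i X) (shift i Y) (\<lambda>n. f (n + i))"
proof -
  have "(\<lambda>g n. g (n + i)) ` (homotopic C X Y `` {f})
      = homotopic C (shift i X) (shift i Y) `` {\<lambda>n. f (n + i)}" (is "?L = ?R")
  proof (intro equalityI subsetI)
    show "g \<in> ?R" if "g \<in> ?L" for g
      using that shift_homotopic by blast
  next
    fix g assume "g \<in> ?R"
    then have "((\<lambda>n. f (n + i)), g) \<in> homotopic C (shift i X) (shift i Y)"
      by blast
    from shift_homotopic[OF this, of "- i"]
    have "(f, (\<lambda>n. g (n - i))) \<in> homotopic C X Y"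
      by (simp add: shift_shift shift_0)
    then show "g \<in> ?L"
      by (intro image_eqI[of _ _ "\<lambda>n. g (n - i)"]) simp_all
  qed
  then show ?thesis
    by (simp add: shift_karr_def homotopy_class_def)
qed

lemma shift_karr_hom:
  assumes "a \<in> Hom (homotopy_cat C) X Y"
  shows "shift_karr i a \<in> Hom (homotopy_cat C) (shift i X) (shift i Y)"
  using assms
  by (elim homotopy_cat_homE)
    (simp add: shift_homotopy_class homotopy_class_hom shift_chain_maps shift_complexes)

lemma shift_karr_Idt:
  "shift_karr i (Idt (homotopy_cat C) X) = Idt (homotopy_cat C) (shift i X)"
  unfolding homotopy_cat_Idt shift_homotopy_class by (simp add: shift_def)

lemma shift_karr_cmp:
  assumes "a \<in> Hom (homotopy_cat C) X Y" "b \<in> Hom (homotopy_cat C) Y Z"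
  shows "shift_karr i (b \<odot>\<^bsub>homotopy_cat C\<^esub> a)
    = shift_karr i b \<odot>\<^bsub>homotopy_cat C\<^esub> shift_karr i a"
  using assms
  by (elim homotopy_cat_homE)
    (simp add: shift_homotopy_class homotopy_class_cmp shift_chain_maps shift_complexes)

text \<open>An equality and not just an isomorphism: the shift without signs only reindexes the
  differentials, so the same chosen kernels and cokernels occur on both sides.\<close>

lemma coh_map_shift:
  "coh_map C (shift i X) (shift i Y) (\<lambda>n. f (n + i)) n = coh_map C X Y f (n + i)"
proof -
  have idx: "n - 1 + i = n + i - 1"
    by simp
  have "coh_proj C (shift i Z) n = coh_proj C Z (n + i)" for Z
    unfolding coh_proj_def idx[symmetric] by (simp add: shift_def)
  then show ?thesis
    unfolding coh_map_def by (simp add: shift_def)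
qed

lemma shift_karr_quasi_isos:
  assumes "s \<in> quasi_isos C"
  shows "shift_karr i s \<in> quasi_isos C"
proof -
  obtain X Y f where "s = homotopy_class C X Y f" "X \<in> complexes C" "Y \<in> complexes C"
    "f \<in> chain_maps C X Y" "\<forall>n. isomorphism C (coh_map C X Y f n)"
    using assms unfolding quasi_isos_def by blast
  then have "shift_karr i s = homotopy_class C (shift i X) (shift i Y) (\<lambda>n. f (n + i))"
    "\<forall>n. isomorphism C (coh_map C (shift i X) (shift i Y) (\<lambda>n. f (n + i)) n)"
    by (simp_all add: shift_homotopy_class coh_map_shift)
  then show ?thesis
    unfolding quasi_isos_def
    using shift_complexes[OF \<open>X \<in> complexes C\<close>] shift_complexes[OF \<open>Y \<in> complexes C\<close>]
      shift_chain_maps[OF \<open>f \<in> chain_maps C X Y\<close>] by blast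
qed

end

section \<open>Zigzags\<close>

lemma zigzag_append:
  "zigzag K S X u Y \<Longrightarrow> zigzag K S Y v Z \<Longrightarrow> zigzag K S X (u @ v) Z"
  by (induction rule: zigzag.induct) (auto intro: zigzag.intros)

lemma zigzag_step_append_right:
  assumes "(u, u') \<in> zigzag_step K S X Y" "zigzag K S Y v Z"
  shows "(u @ v, u' @ v) \<in> zigzag_step K S X Z"
proof -
  obtain a b x y where u: "u = a @ x @ b" "u' = a @ y @ b" and "zigzag_rule K S x y"
    "zigzag K S X u Y" "zigzag K S X u' Y"
    using assms(1) unfolding zigzag_step_def by blast
  moreover have "u @ v = a @ x @ (b @ v)" "u' @ v = a @ y @ (b @ v)"
    using u by simp_all
  ultimately show ?thesis
    unfolding zigzag_step_def using zigzag_append[OF _ assms(2)] by (smt (verit) mem_Collect_eq)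
qed

lemma zigzag_step_append_left:
  assumes "(u, u') \<in> zigzag_step K S Y Z" "zigzag K S X v Y"
  shows "(v @ u, v @ u') \<in> zigzag_step K S X Z"
proof -
  obtain a b x y where u: "u = a @ x @ b" "u' = a @ y @ b" and "zigzag_rule K S x y"
    "zigzag K S Y u Z" "zigzag K S Y u' Z"
    using assms(1) unfolding zigzag_step_def by blast
  moreover have "v @ u = (v @ a) @ x @ b" "v @ u' = (v @ a) @ y @ b"
    using u by simp_all
  ultimately show ?thesis
    unfolding zigzag_step_def using zigzag_append[OF assms(2)] by (smt (verit) mem_Collect_eq)
qed

lemma zigzag_eq_refl: "(w, w) \<in> zigzag_eq K S X Y"
  by (simp add: zigzag_eq_def)

lemma zigzag_eq_sym: "(u, v) \<in> zigzag_eq K S X Y \<Longrightarrow> (v, u) \<in> zigzag_eq K S X Y"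
  unfolding zigzag_eq_def by (meson sym_Un_converse sym_rtrancl symD)

lemma zigzag_eq_trans [trans]:
  "(u, v) \<in> zigzag_eq K S X Y \<Longrightarrow> (v, w) \<in> zigzag_eq K S X Y \<Longrightarrow> (u, w) \<in> zigzag_eq K S X Y"
  unfolding zigzag_eq_def by (rule rtrancl_trans)

lemma zigzag_step_eq: "(u, v) \<in> zigzag_step K S X Y \<Longrightarrow> (u, v) \<in> zigzag_eq K S X Y"
  unfolding zigzag_eq_def by blast

text \<open>Compatibility of an operation on words needs checking on single steps only. It is
  applied to concatenation with a fixed word and to the letterwise action of a functor.\<close>

lemma zigzag_eq_map:
  assumes "(u, v) \<in> zigzag_eq K S X Y"
    and "\<And>a b. (a, b) \<in> zigzag_step K S X Y \<Longrightarrow> (\<phi> a, \<phi> b) \<in> zigzag_step K' S' X' Y'"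
  shows "(\<phi> u, \<phi> v) \<in> zigzag_eq K' S' X' Y'"
  using assms(1) unfolding zigzag_eq_def
proof (induction rule: rtrancl_induct)
  case (step v w)
  then have "(\<phi> v, \<phi> w) \<in> zigzag_step K' S' X' Y' \<union> (zigzag_step K' S' X' Y')\<inverse>"
    using assms(2) by blast
  with step.IH show ?case
    by (rule rtrancl_into_rtrancl)
qed simp

text \<open>\<open>zigzag_eq\<close> is reflexive on all words, composable or not. A step, in either
  direction, relates words that are zigzags from \<open>X\<close> to \<open>Y\<close>, so this
  property spreads from \<open>u\<close>.\<close>

lemma zigzag_eq_zigzag:
  assumes "(u, v) \<in> zigzag_eq K S X Y" "zigzag K S X u Y"
  shows "zigzag K S X v Y"
  using assms unfolding zigzag_eq_def
  by (induction rule: rtrancl_induct) (auto simp: zigzag_step_def)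

lemma zigzag_eq_append:
  assumes "(u, u') \<in> zigzag_eq K S X Y" "(v, v') \<in> zigzag_eq K S Y Z"
    and "zigzag K S X u Y" "zigzag K S Y v Z"
  shows "(u @ v, u' @ v') \<in> zigzag_eq K S X Z"
proof (rule zigzag_eq_trans)
  show "(u @ v, u' @ v) \<in> zigzag_eq K S X Z"
    by (rule zigzag_eq_map[where \<phi> = "\<lambda>a. a @ v", OF assms(1) zigzag_step_append_right[OF _ assms(4)]])
  show "(u' @ v, u' @ v') \<in> zigzag_eq K S X Z"
    by (rule zigzag_eq_map[where \<phi> = "\<lambda>a. u' @ a", OF assms(2)
          zigzag_step_append_left[OF _ zigzag_eq_zigzag[OF assms(1,3)]]])
qed

lemma zigzag_eq_rule:
  assumes "zigzag_rule K S u v" "zigzag K S X (a @ u @ b) Y" "zigzag K S X (a @ v @ b) Y"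
  shows "(a @ u @ b, a @ v @ b) \<in> zigzag_eq K S X Y"
  using assms by (intro zigzag_step_eq) (auto simp: zigzag_step_def)

lemma zigzag_class_eqI:
  "(u, v) \<in> zigzag_eq K S X Y \<Longrightarrow> zigzag_class K S X Y u = zigzag_class K S X Y v"
  unfolding zigzag_class_def by (auto intro: zigzag_eq_trans zigzag_eq_sym)

text \<open>As in the homotopy category: all concatenations of representatives are equivalent to
  \<open>u @ v\<close>, which is one of them.\<close>

lemma zigzag_class_cmp:
  assumes "zigzag K S X u Y" "zigzag K S Y v Z"
  shows "zigzag_class K S Y Z v \<odot>\<^bsub>localization K S\<^esub> zigzag_class K S X Y u
    = zigzag_class K S X Z (u @ v)"
proof -
  let ?T = "{u' @ v' | u' v'. u' \<in> zigzag_eq K S X Y `` {u} \<and> v' \<in> zigzag_eq K S Y Z `` {v}}"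
  have T: "(u @ v, w) \<in> zigzag_eq K S X Z" if "w \<in> ?T" for w
    using that by (auto intro!: zigzag_eq_append assms)
  have "zigzag_eq K S X Z `` ?T = zigzag_eq K S X Z `` {u @ v}"
  proof (intro equalityI subsetI)
    fix x assume "x \<in> zigzag_eq K S X Z `` ?T"
    then obtain w where "w \<in> ?T" "(w, x) \<in> zigzag_eq K S X Z"
      by (rule ImageE)
    then have "(u @ v, x) \<in> zigzag_eq K S X Z"
      by (rule zigzag_eq_trans[OF T])
    then show "x \<in> zigzag_eq K S X Z `` {u @ v}"
      by simp
  next
    fix x assume "x \<in> zigzag_eq K S X Z `` {u @ v}"
    moreover have "u @ v \<in> ?T"
      by (intro CollectI exI[of _ u] exI[of _ v]) (simp add: zigzag_eq_refl)
    ultimately show "x \<in> zigzag_eq K S X Z `` ?T"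
      by (intro ImageI[of "u @ v"]) auto
  qed
  then show ?thesis
    by (simp add: localization_def zigzag_class_def)
qed

lemma zigzag_class_hom:
  "zigzag K S X w Y \<Longrightarrow> zigzag_class K S X Y w \<in> Hom (localization K S) X Y"
  by (auto simp: Hom_def localization_def zigzag_class_def)

section \<open>Functors that respect the arrows to be inverted, acting letter by letter on
  zigzags\<close>

context
  fixes K :: "('o, 'm, 'x) cat_scheme" and K' :: "('p, 'n, 'y) cat_scheme"
    and S S' \<Phi> \<phi>
  assumes \<Phi>: "\<And>X. X \<in> Obj K \<Longrightarrow> \<Phi> X \<in> Obj K'"
    and \<phi>_hom: "\<And>f X Y. f \<in> Hom K X Y \<Longrightarrow> \<phi> f \<in> Hom K' (\<Phi> X) (\<Phi> Y)"
    and \<phi>_idt: "\<And>X. X \<in> Obj K \<Longrightarrow> \<phi> (Idt K X) = Idt K' (\<Phi> X)"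
    and \<phi>_cmp: "\<And>f g X Y Z. f \<in> Hom K X Y \<Longrightarrow> g \<in> Hom K Y Z
      \<Longrightarrow> \<phi> (g \<odot>\<^bsub>K\<^esub> f) = \<phi> g \<odot>\<^bsub>K'\<^esub> \<phi> f"
    and \<phi>_S: "\<And>s. s \<in> S \<Longrightarrow> \<phi> s \<in> S'"
begin

lemma functor_zigzag:
  "zigzag K S X w Y \<Longrightarrow> zigzag K' S' (\<Phi> X) (map (map_letter \<phi>) w) (\<Phi> Y)"
  by (induction rule: zigzag.induct) (auto intro: zigzag.intros \<Phi> \<phi>_hom \<phi>_S)

lemma functor_zigzag_rule:
  "zigzag_rule K S u v \<Longrightarrow> zigzag_rule K' S' (map (map_letter \<phi>) u) (map (map_letter \<phi>) v)"
  by (induction rule: zigzag_rule.induct)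
    (auto simp: \<phi>_idt \<phi>_cmp intro: zigzag_rule.intros \<Phi> \<phi>_hom \<phi>_S)

lemma functor_zigzag_eq:
  assumes "(u, v) \<in> zigzag_eq K S X Y"
  shows "(map (map_letter \<phi>) u, map (map_letter \<phi>) v) \<in> zigzag_eq K' S' (\<Phi> X) (\<Phi> Y)"
proof (rule zigzag_eq_map[OF assms])
  fix a b assume "(a, b) \<in> zigzag_step K S X Y"
  then obtain c d x y where ab: "a = c @ x @ d" "b = c @ y @ d"
    and r: "zigzag_rule K S x y" and z: "zigzag K S X a Y" "zigzag K S X b Y"
    unfolding zigzag_step_def by blast
  show "(map (map_letter \<phi>) a, map (map_letter \<phi>) b) \<in> zigzag_step K' S' (\<Phi> X) (\<Phi> Y)"
    using functor_zigzag_rule[OF r] functor_zigzag[OF z(1)] functor_zigzag[OF z(2)]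
    unfolding zigzag_step_def ab map_append by blast
qed

end

context preadditive_category
begin

text \<open>\<open>shift_darr\<close> closes the letterwise image of a class under equivalence.
  Since the shift is a functor preserving quasi-isomorphisms, this image lies in a single class, and
  one representative determines the result.\<close>

lemma shift_zigzag_class:
  "shift_darr C i (zigzag_class (homotopy_cat C) (quasi_isos C) X Y w)
    = zigzag_class (homotopy_cat C) (quasi_isos C) (shift i X) (shift i Y) (map (map_letter (shift_karr i)) w)"
proof -
  let ?K = "homotopy_cat C" and ?S = "quasi_isos C"
  let ?\<phi> = "map (map_letter (shift_karr i))"
  have "(?\<phi> w, ?\<phi> v) \<in> zigzag_eq ?K ?S (shift i X) (shift i Y)"
    if "(w, v) \<in> zigzag_eq ?K ?S X Y" for v
    by (rule functor_zigzag_eq[OF _ _ _ _ _ that])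
      (simp_all add: shift_complexes shift_karr_hom shift_karr_Idt shift_karr_cmp shift_karr_quasi_isos)
  then have "zigzag_eq ?K ?S (shift i X) (shift i Y) `` (?\<phi> ` (zigzag_eq ?K ?S X Y `` {w}))
      = zigzag_eq ?K ?S (shift i X) (shift i Y) `` {?\<phi> w}"
    using zigzag_eq_refl[of w] zigzag_eq_trans by fast
  then show ?thesis
    by (simp add: shift_darr_def zigzag_class_def)
qed

end

text \<open>Pure word rewriting: \<open>K\<close> is an arbitrary structure, not assumed to be a
  category, which is why the domains and codomains of the composites are given as hypotheses. Words
  are read in the order of application, so the inverse of \<open>s\<close> stands first.\<close>

lemma zigzag_eq_roof_splice:
  assumes T: "T \<in> Hom K L L2" and U: "U \<in> Hom K L L1" and D: "D \<in> Obj K"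
    and s: "s2 \<odot>\<^bsub>K\<^esub> T \<in> S" "s2 \<odot>\<^bsub>K\<^esub> T \<in> Hom K L A" and s2: "s2 \<in> S" "s2 \<in> Hom K L2 A"
    and g2: "g2 \<in> Hom K L2 B" and s1: "s1 \<in> S" "s1 \<in> Hom K L1 B" and g1: "g1 \<in> Hom K L1 D"
    and square: "g2 \<odot>\<^bsub>K\<^esub> T = s1 \<odot>\<^bsub>K\<^esub> U" "s1 \<odot>\<^bsub>K\<^esub> U \<in> Hom K L B"
    and g: "g1 \<odot>\<^bsub>K\<^esub> U \<in> Hom K L D"
  shows "([Bwd (s2 \<odot>\<^bsub>K\<^esub> T), Fwd (g1 \<odot>\<^bsub>K\<^esub> U)], [Bwd s2, Fwd g2, Bwd s1, Fwd g1])
    \<in> zigzag_eq K S A D"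
proof -
  define s where "s = s2 \<odot>\<^bsub>K\<^esub> T"
  note s = s[folded s_def]
  note zz = zigzag.intros D T U s s2 g2 s1 g1 square(2) g
  define E where "E = zigzag_eq K S A D"
  have step: "(w, w') \<in> E"
    if "zigzag_rule K S u v" "w = a @ u @ b" "w' = a @ v @ b" "zigzag K S A w D" "zigzag K S A w' D"
    for a b u v w w'
    using that zigzag_eq_rule unfolding E_def by fast
  \<comment> \<open>The rules merge letters and cancel pairs; splitting a composite letter or
    inserting an inverse pair uses them backwards.\<close>
  have step_sym: "(w', w) \<in> E"
    if "zigzag_rule K S u v" "w = a @ u @ b" "w' = a @ v @ b" "zigzag K S A w D" "zigzag K S A w' D"
    for a b u v w w'
    using step[OF that] zigzag_eq_sym unfolding E_def by fast
  have [trans]: "(u, v) \<in> E \<Longrightarrow> (v, w) \<in> E \<Longrightarrow> (u, w) \<in> E" for u v w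
    unfolding E_def by (rule zigzag_eq_trans)
  have "([Bwd s, Fwd (g1 \<odot>\<^bsub>K\<^esub> U)], [Bwd s, Fwd U, Fwd g1]) \<in> E"
    by (rule step_sym[OF rule_cmp[OF U g1], where a = "[Bwd s]" and b = "[]"]) (auto intro!: zz)
  also have "([Bwd s, Fwd U, Fwd g1], [Bwd s, Fwd U, Fwd s1, Bwd s1, Fwd g1]) \<in> E"
    by (rule step_sym[OF rule_inv_right[OF s1(1)], where a = "[Bwd s, Fwd U]" and b = "[Fwd g1]"])
      (auto intro!: zz)
  also have "([Bwd s, Fwd U, Fwd s1, Bwd s1, Fwd g1], [Bwd s, Fwd (s1 \<odot>\<^bsub>K\<^esub> U), Bwd s1, Fwd g1]) \<in> E"
    by (rule step[OF rule_cmp[OF U s1(2)], where a = "[Bwd s]" and b = "[Bwd s1, Fwd g1]"])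
      (auto intro!: zz)
  \<comment> \<open>The commuting square enters here: the letter \<open>s1 \<odot> U\<close> is read
    as \<open>g2 \<odot> T\<close> and split again.\<close>
  also have "([Bwd s, Fwd (s1 \<odot>\<^bsub>K\<^esub> U), Bwd s1, Fwd g1], [Bwd s, Fwd T, Fwd g2, Bwd s1, Fwd g1]) \<in> E"
    by (rule step_sym[OF rule_cmp[OF T g2], where a = "[Bwd s]" and b = "[Bwd s1, Fwd g1]"])
      (auto simp: square(1) intro!: zz)
  also have "([Bwd s, Fwd T, Fwd g2, Bwd s1, Fwd g1],
      [Bwd s, Fwd T, Fwd s2, Bwd s2, Fwd g2, Bwd s1, Fwd g1]) \<in> E"
    by (rule step_sym[OF rule_inv_right[OF s2(1)], where a = "[Bwd s, Fwd T]" and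
          b = "[Fwd g2, Bwd s1, Fwd g1]"]) (auto intro!: zz)
  also have "([Bwd s, Fwd T, Fwd s2, Bwd s2, Fwd g2, Bwd s1, Fwd g1],
      [Bwd s, Fwd s, Bwd s2, Fwd g2, Bwd s1, Fwd g1]) \<in> E"
    by (rule step[OF rule_cmp[OF T s2(2), folded s_def], where a = "[Bwd s]" and
          b = "[Bwd s2, Fwd g2, Bwd s1, Fwd g1]"]) (auto intro!: zz)
  also have "([Bwd s, Fwd s, Bwd s2, Fwd g2, Bwd s1, Fwd g1], [Bwd s2, Fwd g2, Bwd s1, Fwd g1]) \<in> E"
    by (rule step[OF rule_inv_left[OF s(1)], where a = "[]" and
          b = "[Bwd s2, Fwd g2, Bwd s1, Fwd g1]"]) (auto intro!: zz)
  finally show ?thesis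
    by (simp add: s_def E_def)
qed

section \<open>Classes of exact sequences\<close>

lemma exact_sequence_iff:
  "exact_sequence C ms \<longleftrightarrow> ms \<noteq> [] \<and> exact_at C (Zero C (zero_obj C) (Src C (hd ms))) (hd ms) \<and>
    (\<forall>k. Suc k < length ms \<longrightarrow> exact_at C (ms ! k) (ms ! Suc k)) \<and>
    exact_at C (last ms) (Zero C (Tgt C (last ms)) (zero_obj C))" (is "_ \<longleftrightarrow> ?R")
proof (cases "ms = []")
  case False
  define a where "a = Zero C (zero_obj C) (Src C (hd ms))"
  define b where "b = Zero C (Tgt C (last ms)) (zero_obj C)"
  have "(\<forall>k. Suc k < length (a # ms @ [b]) \<longrightarrow> exact_at C ((a # ms @ [b]) ! k) ((a # ms @ [b]) ! Suc k))
    \<longleftrightarrow> exact_at C a (hd ms) \<and> (\<forall>k. Suc k < length ms \<longrightarrow> exact_at C (ms ! k) (ms ! Suc k)) \<and>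
      exact_at C (last ms) b" (is "?A \<longleftrightarrow> ?B")
  proof
    assume A: ?A
    have "exact_at C a (hd ms)"
      using A[rule_format, of 0] False by (simp add: nth_append hd_conv_nth)
    moreover have "exact_at C (ms ! k) (ms ! Suc k)" if "Suc k < length ms" for k
      using A[rule_format, of "Suc k"] that by (simp add: nth_append)
    moreover have "exact_at C (last ms) b"
      using A[rule_format, of "length ms"] False
      by (cases "length ms") (simp_all add: nth_append last_conv_nth)
    ultimately show ?B
      by blast
  next
    assume B: ?B
    show ?A
    proof (intro allI impI)
      fix k assume k: "Suc k < length (a # ms @ [b])"
      show "exact_at C ((a # ms @ [b]) ! k) ((a # ms @ [b]) ! Suc k)"
      proof (cases k)
        case 0
        then show ?thesis
          using B False by (simp add: nth_append hd_conv_nth)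
      next
        case (Suc l)
        show ?thesis
        proof (cases "Suc l < length ms")
          case True
          then show ?thesis
            using B Suc by (simp add: nth_append)
        next
          case l: False
          then have "l = length ms - 1" "Suc l = length ms"
            using k Suc by simp_all
          then show ?thesis
            using B Suc False by (simp add: nth_append last_conv_nth)
        qed
      qed
    qed
  qed
  then show ?thesis
    using False by (simp add: exact_sequence_def Let_def a_def b_def)
qed (simp add: exact_sequence_def)

context abelian_category
begin

text \<open>Any two parallel arrows into or out of the zero object agree, so a square whose initial
  or final corner is \<open>zero_obj\<close> commutes by itself. For the complexes below few degrees
  remain.\<close>

lemma chain_mapsI:
  assumes X: "X \<in> complexes C" and Y: "Y \<in> complexes C"
    and f: "\<And>n. f n \<in> Hom C (ob X n) (ob Y n)"
    and eq: "\<And>n. ob X n \<noteq> zero_obj C \<Longrightarrow> ob Y (n + 1) \<noteq> zero_obj C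
      \<Longrightarrow> df Y n \<odot> f n = f (n + 1) \<odot> df X n"
  shows "f \<in> chain_maps C X Y"
proof -
  have "df Y n \<odot> f n = f (n + 1) \<odot> df X n" for n
    using eq[of n] hom_zero_obj_unique cmp_hom[OF f complexesD(2)[OF Y], of n]
      cmp_hom[OF complexesD(2)[OF X] f, of n] by metis
  then show ?thesis
    using f by (simp add: chain_maps_def)
qed

lemma stalk_simps:
  "ob (stalk C A) n = (if n = 0 then A else zero_obj C)"
  "df (stalk C A) n = Zero C (ob (stalk C A) n) (ob (stalk C A) (n + 1))"
  by (simp_all add: stalk_def Let_def)

lemma stalk_complexes:
  assumes "A \<in> Obj C"
  shows "stalk C A \<in> complexes C"
proof -
  have ob: "ob (stalk C A) n \<in> Obj C" for n
    using assms by (simp add: stalk_simps(1))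
  show ?thesis
    using ob zero_hom cmp_zero_left[OF zero_hom[OF ob ob] ob]
    by (simp add: complexes_def stalk_simps(2) add.commute)
qed

lemma stalk_exact:
  assumes "A \<in> Obj C" "n \<noteq> 0"
  shows "exact_at C (df (stalk C A) (n - 1)) (df (stalk C A) n)"
  unfolding stalk_simps(2) using assms
  by (simp add: stalk_simps(1) exact_at_zero_obj)

lemma stalk_shift_ob: "ob (shift i (stalk C A)) n = (if n = - i then A else zero_obj C)"
  by (simp add: shift_def stalk_simps)

section \<open>The complex and the roof of an exact sequence, of degree at least 1 so that an arrow
  of the list enters degree 0\<close>

context
  fixes ms :: "'m list"
  assumes ms: "exact_sequence C ms" and len: "2 \<le> length ms"
begin

lemma exact_sequenceD:
  shows "exact_at C (Zero C (zero_obj C) (Src C (ms ! 0))) (ms ! 0)"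
    and "Suc k < length ms \<Longrightarrow> exact_at C (ms ! k) (ms ! Suc k)"
    and "exact_at C (last ms) (Zero C (Tgt C (last ms)) (zero_obj C))"
  using ms by (auto simp: exact_sequence_iff hd_conv_nth)

lemma exact_sequence_hom:
  assumes "Suc k < length ms"
  shows "ms ! k \<in> Hom C (Src C (ms ! k)) (Src C (ms ! Suc k))"
  using exact_sequenceD(2)[OF assms] by (simp add: exact_at_def Hom_def)

lemma exact_sequence_last_hom: "last ms \<in> Hom C (Src C (last ms)) (Tgt C (last ms))"
  using exact_sequenceD(3) by (simp add: exact_at_def Hom_def)

lemma exact_sequence_Arr:
  assumes "k < length ms"
  shows "ms ! k \<in> Arr C"
proof (cases "Suc k < length ms")
  case True
  then show ?thesis
    using homD(1)[OF exact_sequence_hom] by simp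
next
  case False
  then have "k = length ms - 1" "ms \<noteq> []"
    using assms by auto
  then have "ms ! k = last ms"
    by (simp add: last_conv_nth)
  then show ?thesis
    using homD(1)[OF exact_sequence_last_hom] by simp
qed

lemma yoneda_cx_ob:
  "ob (yoneda_cx C ms) n =
    (if - yoneda_degree ms \<le> n \<and> n \<le> 0 then Src C (ms ! nat (n + yoneda_degree ms)) else zero_obj C)"
  by (simp add: yoneda_cx_def Let_def)

lemma yoneda_cx_df:
  "df (yoneda_cx C ms) n =
    (if - yoneda_degree ms \<le> n \<and> n < 0 then ms ! nat (n + yoneda_degree ms)
     else Zero C (ob (yoneda_cx C ms) n) (ob (yoneda_cx C ms) (n + 1)))"
  by (simp add: yoneda_cx_def Let_def)

lemma yoneda_cx_ob_Obj: "ob (yoneda_cx C ms) n \<in> Obj C"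
proof -
  have "nat (n + yoneda_degree ms) < length ms" if "n \<le> 0"
    using that len by (auto simp: yoneda_degree_def)
  then show ?thesis
    using src_obj exact_sequence_Arr by (simp add: yoneda_cx_ob)
qed

lemma yoneda_cx_ob_0: "ob (yoneda_cx C ms) 0 = Src C (last ms)"
proof -
  have "nat (yoneda_degree ms) = length ms - 1" "ms \<noteq> []"
    using len by (auto simp: yoneda_degree_def)
  then show ?thesis
    using len by (simp add: yoneda_cx_ob last_conv_nth) (simp add: yoneda_degree_def)
qed

lemma yoneda_cx_df_hom:
  "df (yoneda_cx C ms) n \<in> Hom C (ob (yoneda_cx C ms) n) (ob (yoneda_cx C ms) (n + 1))"
proof (cases "- yoneda_degree ms \<le> n \<and> n < 0")
  case True
  then have idx: "nat (n + 1 + yoneda_degree ms) = Suc (nat (n + yoneda_degree ms))"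
    "Suc (nat (n + yoneda_degree ms)) < length ms"
    by (auto simp: yoneda_degree_def)
  then show ?thesis
    using exact_sequence_hom[OF idx(2)] True unfolding yoneda_cx_df yoneda_cx_ob by simp
next
  case False
  then show ?thesis
    using zero_hom[OF yoneda_cx_ob_Obj yoneda_cx_ob_Obj] unfolding yoneda_cx_df by auto
qed

lemma yoneda_cx_exact_range:
  assumes "- yoneda_degree ms < n" "n < 0"
  shows "exact_at C (df (yoneda_cx C ms) (n - 1)) (df (yoneda_cx C ms) n)"
proof -
  define k where "k = nat (n - 1 + yoneda_degree ms)"
  have "nat (n + yoneda_degree ms) = Suc k" "Suc k < length ms"
    using assms by (auto simp: yoneda_degree_def k_def)
  then show ?thesis
    using assms exact_sequenceD(2)[of k] unfolding yoneda_cx_df by (simp add: k_def)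
qed

text \<open>Outside the range the object is zero; at the left end exactness is that of the initial
  zero and the first arrow; in between it is given by the list. Degree 0 is excluded because the
  last arrow of the list is not a differential but becomes the map \<open>yoneda_s\<close>.\<close>

lemma yoneda_cx_exact:
  assumes "n \<noteq> 0"
  shows "exact_at C (df (yoneda_cx C ms) (n - 1)) (df (yoneda_cx C ms) n)"
proof -
  have deg: "0 < yoneda_degree ms"
    using len by (simp add: yoneda_degree_def)
  consider "n < - yoneda_degree ms \<or> 0 < n" | "n = - yoneda_degree ms"
    | "- yoneda_degree ms < n" "n < 0"
    using assms by linarith
  then show ?thesis
  proof cases
    case 1
    then have "ob (yoneda_cx C ms) n = zero_obj C"
      by (auto simp: yoneda_cx_ob)
    then have "df (yoneda_cx C ms) (n - 1) = Zero C (ob (yoneda_cx C ms) (n - 1)) (zero_obj C)"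
      "df (yoneda_cx C ms) n = Zero C (zero_obj C) (ob (yoneda_cx C ms) (n + 1))"
      using 1 unfolding yoneda_cx_df by auto
    then show ?thesis
      using exact_at_zero_obj yoneda_cx_ob_Obj by simp
  next
    case 2
    then have "df (yoneda_cx C ms) (n - 1) = Zero C (zero_obj C) (Src C (ms ! 0))"
      "df (yoneda_cx C ms) n = ms ! 0"
      using deg unfolding yoneda_cx_df by (auto simp: yoneda_cx_ob)
    then show ?thesis
      using exact_sequenceD(1) by simp
  next
    case 3
    then show ?thesis
      by (rule yoneda_cx_exact_range)
  qed
qed

lemma yoneda_cx_complexes: "yoneda_cx C ms \<in> complexes C"
proof -
  have "df (yoneda_cx C ms) (n + 1) \<odot> df (yoneda_cx C ms) n
      = Zero C (ob (yoneda_cx C ms) n) (ob (yoneda_cx C ms) (n + 2))" for n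
  proof (cases "n + 1 = 0")
    case True
    have "df (yoneda_cx C ms) (n + 1) = Zero C (ob (yoneda_cx C ms) (n + 1)) (ob (yoneda_cx C ms) (n + 1 + 1))"
      using True unfolding yoneda_cx_df by simp
    then show ?thesis
      using cmp_zero_left[OF yoneda_cx_df_hom[of n] yoneda_cx_ob_Obj[of "n + 1 + 1"]]
      by (simp add: add.assoc)
  next
    case False
    then show ?thesis
      using exact_at_cmp[OF yoneda_cx_df_hom[of n] yoneda_cx_df_hom[of "n + 1"]]
        yoneda_cx_exact[of "n + 1"] by (simp add: add.assoc)
  qed
  then show ?thesis
    using yoneda_cx_ob_Obj yoneda_cx_df_hom by (simp add: complexes_def)
qed

text \<open>Exactness at the right end makes the last arrow epic, and exactness one place earlier
  turns an epic into a cokernel. This is the input for the degree 0 part of the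
  quasi-isomorphism.\<close>

lemma last_cokernel: "is_cokernel C (last ms) (df (yoneda_cx C ms) (- 1))"
  and yoneda_cx_df_last: "df (yoneda_cx C ms) (- 1) \<in> Hom C (ob (yoneda_cx C ms) (- 1)) (Src C (last ms))"
proof -
  have k: "nat (- 1 + yoneda_degree ms) = length ms - 2" "Suc (length ms - 2) = length ms - 1"
    "Suc (length ms - 2) < length ms" "ms \<noteq> []" "0 < yoneda_degree ms"
    using len by (auto simp: yoneda_degree_def)
  have d: "df (yoneda_cx C ms) (- 1) = ms ! (length ms - 2)"
    using k unfolding yoneda_cx_df by simp
  show hom: "df (yoneda_cx C ms) (- 1) \<in> Hom C (ob (yoneda_cx C ms) (- 1)) (Src C (last ms))"
    using yoneda_cx_df_hom[of "- 1"] yoneda_cx_ob_0 by simp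
  have "exact_at C (df (yoneda_cx C ms) (- 1)) (last ms)"
    using exact_sequenceD(2)[OF k(3)] k by (simp add: d last_conv_nth)
  then show "is_cokernel C (last ms) (df (yoneda_cx C ms) (- 1))"
    using exact_at_cokernel[OF hom exact_sequence_last_hom]
      exact_at_epicD[OF exact_sequence_last_hom zero_obj_Obj exact_sequenceD(3)] by blast
qed

abbreviation yoneda_s_map :: "int \<Rightarrow> 'm" where
  "yoneda_s_map \<equiv> \<lambda>n. if n = 0 then last ms
    else Zero C (ob (yoneda_cx C ms) n) (ob (stalk C (Tgt C (last ms))) n)"

lemma yoneda_target_Obj: "Tgt C (last ms) \<in> Obj C"
  using hom_objs(2)[OF exact_sequence_last_hom] .

lemma yoneda_source_Obj: "Src C (hd ms) \<in> Obj C"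
proof -
  have "ms \<noteq> []"
    using len by auto
  then have "hd ms = ms ! 0" "0 < length ms"
    by (simp_all add: hd_conv_nth)
  then show ?thesis
    using src_obj exact_sequence_Arr by simp
qed

lemma yoneda_s_chain_map:
  "yoneda_s_map \<in> chain_maps C (yoneda_cx C ms) (stalk C (Tgt C (last ms)))"
proof (rule chain_mapsI[OF yoneda_cx_complexes stalk_complexes[OF yoneda_target_Obj]])
  let ?X = "yoneda_cx C ms" and ?Y = "stalk C (Tgt C (last ms))"
  note Y = complexesD[OF stalk_complexes[OF yoneda_target_Obj]]
  show hom: "yoneda_s_map n \<in> Hom C (ob ?X n) (ob ?Y n)" for n
    using exact_sequence_last_hom yoneda_cx_ob_0 zero_hom[OF yoneda_cx_ob_Obj zero_obj_Obj]
    by (simp add: stalk_simps(1))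
  \<comment> \<open>The stalk can be nonzero only in degree 0, so the one square left starts in
    degree -1; both of its composites vanish.\<close>
  fix n assume "ob ?Y (n + 1) \<noteq> zero_obj C"
  then have n: "n = - 1"
    by (simp add: stalk_simps split: if_splits)
  have "df ?Y (- 1) \<odot> yoneda_s_map (- 1) = Zero C (ob ?X (- 1)) (Tgt C (last ms))"
    using cmp_zero_left[OF hom[of "- 1"] Y(1)[of 0]] unfolding stalk_simps(2)
    by (simp add: stalk_simps(1))
  moreover have "last ms \<odot> df ?X (- 1) = Zero C (ob ?X (- 1)) (Tgt C (last ms))"
    using cokernel_cmp[OF last_cokernel exact_sequence_last_hom yoneda_cx_df_last] .
  ultimately show "df ?Y n \<odot> yoneda_s_map n = yoneda_s_map (n + 1) \<odot> df ?X n"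
    unfolding n by simp
qed

lemma yoneda_s_hom: "yoneda_s C ms \<in> Hom (homotopy_cat C) (yoneda_cx C ms) (stalk C (Tgt C (last ms)))"
  unfolding yoneda_s_def Let_def
  by (rule homotopy_class_hom[OF yoneda_cx_complexes stalk_complexes[OF yoneda_target_Obj]
        yoneda_s_chain_map])

text \<open>Off degree 0 both complexes are exact, so the map goes between vanishing cohomology
  objects. In degree 0 the last arrow is a cokernel of the incoming differential.\<close>

lemma yoneda_s_quasi_iso: "yoneda_s C ms \<in> quasi_isos C"
proof -
  let ?X = "yoneda_cx C ms" and ?Y = "stalk C (Tgt C (last ms))"
  note X = yoneda_cx_complexes and Y = stalk_complexes[OF yoneda_target_Obj]
  have "isomorphism C (coh_map C ?X ?Y yoneda_s_map n)" for n
  proof (cases "n = 0")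
    case True
    show ?thesis
      unfolding True
    proof (rule coh_map_isomorphism_cokernel[OF X Y yoneda_s_chain_map])
      show "df ?X 0 = Zero C (ob ?X 0) (ob ?X (0 + 1))"
        unfolding yoneda_cx_df by simp
      show "df ?Y 0 = Zero C (ob ?Y 0) (ob ?Y (0 + 1))"
        by (rule stalk_simps(2))
      show "df ?Y (0 - 1) = Zero C (ob ?Y (0 - 1)) (ob ?Y 0)"
        using stalk_simps(2)[of _ "- 1"] by simp
      show "is_cokernel C (yoneda_s_map 0) (df ?X (0 - 1))"
        using last_cokernel by simp
    qed
  next
    case False
    then show ?thesis
      using coh_map_isomorphism_exact[OF X Y yoneda_s_chain_map yoneda_cx_exact
          stalk_exact[OF yoneda_target_Obj]] by blast
  qed
  then show ?thesis
    unfolding quasi_isos_def yoneda_s_def Let_def using X Y yoneda_s_chain_map by blast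
qed

abbreviation yoneda_g_map :: "int \<Rightarrow> 'm" where
  "yoneda_g_map \<equiv> \<lambda>n. if n = - yoneda_degree ms then Idt C (Src C (hd ms))
    else Zero C (ob (yoneda_cx C ms) n) (ob (shift (yoneda_degree ms) (stalk C (Src C (hd ms)))) n)"

lemma yoneda_g_chain_map:
  "yoneda_g_map \<in> chain_maps C (yoneda_cx C ms) (shift (yoneda_degree ms) (stalk C (Src C (hd ms))))"
proof (rule chain_mapsI[OF yoneda_cx_complexes shift_complexes[OF stalk_complexes[OF yoneda_source_Obj]]])
  let ?X = "yoneda_cx C ms" and ?Y = "shift (yoneda_degree ms) (stalk C (Src C (hd ms)))"
  note Y = complexesD[OF shift_complexes[OF stalk_complexes[OF yoneda_source_Obj]]]
  have "ms \<noteq> []" "0 \<le> yoneda_degree ms"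
    using len by (auto simp: yoneda_degree_def)
  then have "ob ?X (- yoneda_degree ms) = Src C (hd ms)"
    by (simp add: yoneda_cx_ob hd_conv_nth)
  then show "yoneda_g_map n \<in> Hom C (ob ?X n) (ob ?Y n)" for n
    using idt_hom[OF yoneda_source_Obj] zero_hom[OF yoneda_cx_ob_Obj zero_obj_Obj]
    by (simp add: stalk_shift_ob)
  \<comment> \<open>No square is left: with i the degree, a nonzero source needs
    \<open>- i \<le> n\<close>, a nonzero target \<open>n + 1 = - i\<close>.\<close>
  fix n assume "ob ?X n \<noteq> zero_obj C" "ob ?Y (n + 1) \<noteq> zero_obj C"
  then show "df ?Y n \<odot> yoneda_g_map n = yoneda_g_map (n + 1) \<odot> df ?X n"
    by (auto simp: yoneda_cx_ob stalk_shift_ob split: if_splits)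
qed

lemma yoneda_g_hom:
  "yoneda_g C ms \<in> Hom (homotopy_cat C) (yoneda_cx C ms)
    (shift (yoneda_degree ms) (stalk C (Src C (hd ms))))"
  unfolding yoneda_g_def Let_def
  by (rule homotopy_class_hom[OF yoneda_cx_complexes
        shift_complexes[OF stalk_complexes[OF yoneda_source_Obj]] yoneda_g_chain_map])

lemma yoneda_zigzag:
  "zigzag (homotopy_cat C) (quasi_isos C) (stalk C (Tgt C (last ms))) [Bwd (yoneda_s C ms), Fwd (yoneda_g C ms)]
    (shift (yoneda_degree ms) (stalk C (Src C (hd ms))))"
  by (rule zigzag_Bwd[OF yoneda_s_quasi_iso yoneda_s_hom] zigzag_Fwd[OF yoneda_g_hom] zigzag_Nil)+
    (simp add: shift_complexes[OF stalk_complexes[OF yoneda_source_Obj]])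

lemma yoneda_class_eq:
  "yoneda_class C ms = zigzag_class (homotopy_cat C) (quasi_isos C) (stalk C (Tgt C (last ms)))
    (shift (yoneda_degree ms) (stalk C (Src C (hd ms)))) [Bwd (yoneda_s C ms), Fwd (yoneda_g C ms)]"
  using homD(3)[OF yoneda_s_hom] homD(3)[OF yoneda_g_hom] by (simp add: yoneda_class_def roof_def)

lemma yoneda_class_Ext:
  "yoneda_class C ms \<in> Ext C (length ms - 1) (Tgt C (last ms)) (Src C (hd ms))"
proof -
  have "yoneda_degree ms = int (length ms - 1)"
    using len by (simp add: yoneda_degree_def)
  then show ?thesis
    using zigzag_class_hom[OF yoneda_zigzag] by (simp add: Ext_def derived_cat_def yoneda_class_eq)
qed

end

end

section \<open>The product formula for a spliced sequence\<close>

context abelian_category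
begin

text \<open>Into a shifted stalk this leaves a single degree to compare.\<close>

lemma chain_map_eqI:
  assumes f: "f \<in> chain_maps C X Y" and g: "g \<in> chain_maps C X Y"
    and eq: "\<And>n. ob Y n \<noteq> zero_obj C \<Longrightarrow> f n = g n"
  shows "f = g"
proof
  fix n
  show "f n = g n"
    using eq[of n] hom_zero_obj_unique(1) chain_mapsD(1)[OF f, of n] chain_mapsD(1)[OF g, of n]
    by metis
qed

text \<open>The filtration is gone: what remains is a four-term sequence cut at \<open>Q\<close>
  into two short exact ones, its middle arrow given as the composite through
  \<open>Q\<close>.\<close>

lemma yoneda_class_splice:
  assumes ex: "exact_sequence C [j, m \<odot> r, q]" "exact_sequence C [j, r]" "exact_sequence C [m, q]"
    and j: "j \<in> Hom C F1 F2" and r: "r \<in> Hom C F2 Q" and m: "m \<in> Hom C Q E" and q: "q \<in> Hom C E G"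
  shows "yoneda_class C [j, m \<odot> r, q] = yoneda_product C (yoneda_class C [j, r]) (yoneda_class C [m, q])"
proof -
  let ?K = "homotopy_cat C" and ?S = "quasi_isos C"
  define L where "L = yoneda_cx C [j, m \<odot> r, q]"
  define L1 where "L1 = shift 1 (yoneda_cx C [j, r])"
  define L2 where "L2 = yoneda_cx C [m, q]"
  have len: "2 \<le> length [j, m \<odot> r, q]" "2 \<le> length [j, r]" "2 \<le> length [m, q]"
    by simp_all
  have mr: "m \<odot> r \<in> Hom C F2 E"
    using cmp_hom[OF r m] .
  note SrcTgt = homD(2,3)[OF j] homD(2,3)[OF r] homD(2,3)[OF m] homD(2,3)[OF q] homD(2,3)[OF mr]
  have L: "L \<in> complexes C" and L1: "L1 \<in> complexes C" and L2: "L2 \<in> complexes C"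
    using yoneda_cx_complexes[OF ex(1) len(1)] yoneda_cx_complexes[OF ex(3) len(3)]
      shift_complexes[OF yoneda_cx_complexes[OF ex(2) len(2)]]
    by (simp_all add: L_def L1_def L2_def)
  \<comment> \<open>\<open>L1\<close> already contains the shift, so F1 and F2 sit in the same
    degrees in \<open>L1\<close> and in \<open>L\<close>.\<close>
  have obL: "ob L n = (if n = - 2 then F1 else if n = - 1 then F2 else if n = 0 then E else zero_obj C)"
    and obL1: "ob L1 n = (if n = - 2 then F1 else if n = - 1 then F2 else zero_obj C)"
    and obL2: "ob L2 n = (if n = - 1 then Q else if n = 0 then E else zero_obj C)" for n
    by (auto simp: L_def L1_def L2_def yoneda_cx_def yoneda_degree_def shift_def SrcTgt)
  have dfL: "df L (- 2) = j" "df L (- 1) = m \<odot> r" and dfL1: "df L1 (- 2) = j"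
    and dfL2: "df L2 (- 1) = m" "df L2 (- 2) = Zero C (zero_obj C) Q"
    by (auto simp: L_def L1_def L2_def yoneda_cx_def yoneda_degree_def shift_def SrcTgt)
  define t where "t n = (if n = 0 then Idt C E else if n = - 1 then r else Zero C (ob L n) (ob L2 n))" for n
  define u where "u n = (if n = - 2 then Idt C F1 else if n = - 1 then Idt C F2 else Zero C (ob L n) (ob L1 n))" for n
  \<comment> \<open>This makes \<open>t\<close> commute with the differentials out of degree -2,
    where \<open>t\<close> itself is zero.\<close>
  have rj: "r \<odot> j = Zero C F1 Q"
    using exact_at_cmp[OF j r] exact_sequenceD(2)[OF ex(2) len(2), of 0] by simp
  note idt = idt_hom[OF hom_objs(1)[OF j]] idt_hom[OF hom_objs(1)[OF r]] idt_hom[OF hom_objs(1)[OF q]]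
  have t: "t \<in> chain_maps C L L2"
  proof (rule chain_mapsI[OF L L2])
    show "t n \<in> Hom C (ob L n) (ob L2 n)" for n
      using idt(3) r zero_hom[OF complexesD(1)[OF L, of n] complexesD(1)[OF L2, of n]]
      unfolding t_def by (auto simp: obL obL2)
    fix n assume "ob L n \<noteq> zero_obj C" "ob L2 (n + 1) \<noteq> zero_obj C"
    then consider "n = - 2" | "n = - 1"
      by (auto simp: obL obL2 split: if_splits)
    then show "df L2 n \<odot> t n = t (n + 1) \<odot> df L n"
    proof cases
      case 1
      then show ?thesis
        using rj cmp_zero_left[OF zero_hom[OF hom_objs(1)[OF j] zero_obj_Obj] hom_objs(1)[OF m]]
        by (simp add: t_def dfL dfL2 obL obL2)
    next
      case 2
      then show ?thesis
        using cmp_idt_left[OF mr] by (simp add: t_def dfL dfL2)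
    qed
  qed
  have u: "u \<in> chain_maps C L L1"
  proof (rule chain_mapsI[OF L L1])
    show "u n \<in> Hom C (ob L n) (ob L1 n)" for n
      using idt(1,2) zero_hom[OF complexesD(1)[OF L, of n] complexesD(1)[OF L1, of n]]
      unfolding u_def by (auto simp: obL obL1)
    fix n assume "ob L n \<noteq> zero_obj C" "ob L1 (n + 1) \<noteq> zero_obj C"
    \<comment> \<open>The square from degree -1 ends in degree 0, where \<open>L1\<close> is zero,
      so \<open>m \<odot> r\<close> imposes no condition on \<open>u\<close>.\<close>
    then have "n = - 2"
      by (auto simp: obL obL1 split: if_splits)
    then show "df L1 n \<odot> u n = u (n + 1) \<odot> df L n"
      using cmp_idt_left[OF j] cmp_idt_right[OF j] by (simp add: u_def dfL dfL1)
  qed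
  let ?sm = "yoneda_s_map [j, m \<odot> r, q]" and ?gm = "yoneda_g_map [j, m \<odot> r, q]"
  let ?sm2 = "yoneda_s_map [m, q]" and ?gm2 = "yoneda_g_map [m, q]"
  let ?sm1 = "\<lambda>n. yoneda_s_map [j, r] (n + 1)" and ?gm1 = "\<lambda>n. yoneda_g_map [j, r] (n + 1)"
  define A where "A = stalk C G"
  define B where "B = shift 1 (stalk C Q)"
  define D where "D = shift 2 (stalk C F1)"
  have A: "A \<in> complexes C" and B: "B \<in> complexes C" and D: "D \<in> complexes C"
    using stalk_complexes shift_complexes hom_objs[OF j] hom_objs[OF r] hom_objs[OF q]
    by (simp_all add: A_def B_def D_def)
  have obB: "ob A n = (if n = 0 then G else zero_obj C)"
    "ob B n = (if n = - 1 then Q else zero_obj C)"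
    "ob D n = (if n = - 2 then F1 else zero_obj C)" for n
    by (simp_all add: A_def B_def D_def stalk_shift_ob stalk_simps(1))
  have sm: "?sm \<in> chain_maps C L A" and gm: "?gm \<in> chain_maps C L D"
    using yoneda_s_chain_map[OF ex(1) len(1)] yoneda_g_chain_map[OF ex(1) len(1)]
    by (simp_all add: L_def A_def D_def SrcTgt yoneda_degree_def)
  have sm2: "?sm2 \<in> chain_maps C L2 A" and gm2: "?gm2 \<in> chain_maps C L2 B"
    using yoneda_s_chain_map[OF ex(3) len(3)] yoneda_g_chain_map[OF ex(3) len(3)]
    by (simp_all add: L2_def A_def B_def SrcTgt yoneda_degree_def)
  have sm1: "?sm1 \<in> chain_maps C L1 B" and gm1: "?gm1 \<in> chain_maps C L1 D"
    using shift_chain_maps[OF yoneda_s_chain_map[OF ex(2) len(2)], of 1]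
      shift_chain_maps[OF yoneda_g_chain_map[OF ex(2) len(2)], of 1]
    by (simp_all add: L1_def B_def D_def SrcTgt yoneda_degree_def shift_shift)
  \<comment> \<open>The targets of the three identities are concentrated in degrees 0, -2 and -1.
    There they read \<open>q = q\<close>, identity of F1, and \<open>r = r\<close>.\<close>
  have s_eq: "(\<lambda>n. ?sm2 n \<odot> t n) = ?sm"
    by (rule chain_map_eqI[OF cmp_chain_maps[OF L L2 A t sm2] sm])
      (simp add: obB t_def cmp_idt_right[OF q] split: if_splits)
  have g_eq: "(\<lambda>n. ?gm1 n \<odot> u n) = ?gm"
    by (rule chain_map_eqI[OF cmp_chain_maps[OF L L1 D u gm1] gm])
      (simp add: obB u_def SrcTgt yoneda_degree_def cmp_idt_right[OF idt(1)] split: if_splits)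
  have square: "(\<lambda>n. ?gm2 n \<odot> t n) = (\<lambda>n. ?sm1 n \<odot> u n)"
    by (rule chain_map_eqI[OF cmp_chain_maps[OF L L2 B t gm2] cmp_chain_maps[OF L L1 B u sm1]])
      (simp add: obB t_def u_def SrcTgt yoneda_degree_def cmp_idt_right[OF r] cmp_idt_left[OF r]
        split: if_splits)
  define s where "s = yoneda_s C [j, m \<odot> r, q]"
  define g where "g = yoneda_g C [j, m \<odot> r, q]"
  define s2 where "s2 = yoneda_s C [m, q]"
  define g2 where "g2 = yoneda_g C [m, q]"
  define s1 where "s1 = shift_karr 1 (yoneda_s C [j, r])"
  define g1 where "g1 = shift_karr 1 (yoneda_g C [j, r])"
  have cls: "s = homotopy_class C L A ?sm" "g = homotopy_class C L D ?gm"
    "s2 = homotopy_class C L2 A ?sm2" "g2 = homotopy_class C L2 B ?gm2"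
    by (simp_all add: s_def g_def s2_def g2_def yoneda_s_def yoneda_g_def Let_def L_def L2_def
        A_def B_def D_def SrcTgt yoneda_degree_def cong: if_cong)
  have cls1: "s1 = homotopy_class C L1 B ?sm1" "g1 = homotopy_class C L1 D ?gm1"
    by (simp_all add: s1_def g1_def yoneda_s_def yoneda_g_def Let_def shift_homotopy_class L1_def
        B_def D_def SrcTgt yoneda_degree_def shift_shift cong: if_cong)
  have qis: "s \<in> ?S" "s2 \<in> ?S" "s1 \<in> ?S"
    unfolding s_def s2_def s1_def
    by (rule yoneda_s_quasi_iso[OF ex(1) len(1)] yoneda_s_quasi_iso[OF ex(3) len(3)]
        shift_karr_quasi_isos[OF yoneda_s_quasi_iso[OF ex(2) len(2)]])+
  define T where "T = homotopy_class C L L2 t"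
  define U where "U = homotopy_class C L L1 u"
  have T: "T \<in> Hom ?K L L2" and U: "U \<in> Hom ?K L L1"
    unfolding T_def U_def by (rule homotopy_class_hom[OF L L2 t] homotopy_class_hom[OF L L1 u])+
  have homs: "s \<in> Hom ?K L A" "g \<in> Hom ?K L D" "s2 \<in> Hom ?K L2 A" "g2 \<in> Hom ?K L2 B"
    "s1 \<in> Hom ?K L1 B" "g1 \<in> Hom ?K L1 D"
    unfolding cls cls1
    by (rule homotopy_class_hom[OF L A sm] homotopy_class_hom[OF L D gm]
        homotopy_class_hom[OF L2 A sm2] homotopy_class_hom[OF L2 B gm2]
        homotopy_class_hom[OF L1 B sm1] homotopy_class_hom[OF L1 D gm1])+
  have sT: "s2 \<odot>\<^bsub>?K\<^esub> T = s" and gU: "g1 \<odot>\<^bsub>?K\<^esub> U = g"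
    and sq: "g2 \<odot>\<^bsub>?K\<^esub> T = s1 \<odot>\<^bsub>?K\<^esub> U"
    unfolding cls cls1 T_def U_def homotopy_class_cmp[OF L L2 A t sm2]
      homotopy_class_cmp[OF L L1 D u gm1] homotopy_class_cmp[OF L L2 B t gm2]
      homotopy_class_cmp[OF L L1 B u sm1] s_eq g_eq square
    by (rule refl)+
  have eq: "([Bwd s, Fwd g], [Bwd s2, Fwd g2, Bwd s1, Fwd g1]) \<in> zigzag_eq ?K ?S A D"
    unfolding sT[symmetric] gU[symmetric]
    by (rule zigzag_eq_roof_splice[OF T U, where B = B])
      (simp_all add: sT gU sq D qis homs homotopy_cat_cmp_hom[OF U homs(5)])
  have z2: "zigzag ?K ?S A [Bwd s2, Fwd g2] B" and z1: "zigzag ?K ?S B [Bwd s1, Fwd g1] D"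
    using qis homs B D by (auto intro!: zigzag.intros)
  have "yoneda_class C [j, m \<odot> r, q] = zigzag_class ?K ?S A D [Bwd s, Fwd g]"
    using yoneda_class_eq[OF ex(1) len(1)]
    by (simp add: A_def D_def s_def g_def SrcTgt yoneda_degree_def)
  also have "\<dots> = zigzag_class ?K ?S A D ([Bwd s2, Fwd g2] @ [Bwd s1, Fwd g1])"
    using zigzag_class_eqI[OF eq] by simp
  also have "\<dots> = zigzag_class ?K ?S B D [Bwd s1, Fwd g1] \<odot>\<^bsub>localization ?K ?S\<^esub>
      zigzag_class ?K ?S A B [Bwd s2, Fwd g2]"
    by (rule zigzag_class_cmp[OF z2 z1, symmetric])
  \<comment> \<open>The shifted roof ends in F1[1][1], which \<open>shift_shift\<close> identifies
    with F1[2], the target of the class of the long sequence.\<close>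
  also have "zigzag_class ?K ?S B D [Bwd s1, Fwd g1] = shift_darr C 1 (yoneda_class C [j, r])"
    using yoneda_class_eq[OF ex(2) len(2)]
    by (simp add: shift_zigzag_class s1_def g1_def B_def D_def SrcTgt yoneda_degree_def shift_shift)
  also have "zigzag_class ?K ?S A B [Bwd s2, Fwd g2] = yoneda_class C [m, q]"
    using yoneda_class_eq[OF ex(3) len(3)]
    by (simp add: s2_def g2_def A_def B_def SrcTgt yoneda_degree_def)
  finally show ?thesis
    by (simp add: yoneda_product_def derived_cat_def)
qed

section \<open>Exactness of the three sequences of the filtration\<close>

lemma exact_sequence_short:
  assumes j: "j \<in> Hom C A B" "monic C j" and r: "r \<in> Hom C B D" "is_cokernel C r j"
  shows "exact_sequence C [j, r]"
proof -
  have "exact_at C j r"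
    using exact_atI[OF r(2)] monic_kernel_cokernel[OF j(2) r(2)] by blast
  then show ?thesis
    using exact_at_monic[OF j] exact_at_epic[OF r(1) cokernel_epic[OF r(2)]]
    by (simp add: exact_sequence_iff homD[OF j(1)] homD[OF r(1)])
qed

text \<open>Composing with the monic \<open>m\<close> leaves the kernel of \<open>r\<close>
  unchanged, and composing with the epic \<open>r\<close> leaves the cokernel of \<open>m\<close>
  unchanged.\<close>

lemma exact_sequence_splice:
  assumes j: "j \<in> Hom C A B" "monic C j" and r: "r \<in> Hom C B Q" "is_cokernel C r j"
    and m: "m \<in> Hom C Q E" "monic C m" and q: "q \<in> Hom C E G" "is_cokernel C q m"
  shows "exact_sequence C [j, m \<odot> r, q]"
proof -
  have mr: "m \<odot> r \<in> Hom C B E"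
    using cmp_hom[OF r(1) m(1)] .
  have jr: "is_kernel C j r"
    by (rule monic_kernel_cokernel[OF j(2) r(2)])
  have "is_kernel C j (m \<odot> r)"
  proof (rule is_kernelI[OF j(1) mr _ _ j(2)])
    show "(m \<odot> r) \<odot> j = Zero C A E"
      using cmp_assoc[OF j(1) r(1) m(1)] kernel_cmp[OF jr j(1) r(1)]
        cmp_zero_right[OF m(1) hom_objs(1)[OF j(1)]] by simp
  next
    fix X x assume x: "x \<in> Hom C X B" "(m \<odot> r) \<odot> x = Zero C X E"
    have X: "X \<in> Obj C"
      using hom_objs(1)[OF x(1)] .
    have "r \<odot> x = Zero C X Q"
      by (rule monicD[OF m(2,1) cmp_hom[OF x(1) r(1)] zero_hom[OF X hom_objs(1)[OF m(1)]]])
        (use cmp_assoc[OF x(1) r(1) m(1)] x(2) cmp_zero_right[OF m(1) X] in simp)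
    then show "\<exists>z \<in> Hom C X A. j \<odot> z = x"
      using kernel_ex1[OF jr j(1) r(1) x(1)] by blast
  qed
  then have "exact_at C j (m \<odot> r)"
    by (rule exact_atI[OF r(2) jr])
  moreover have "is_cokernel C q (m \<odot> r)"
  proof (rule is_cokernelI[OF q(1) mr _ _ cokernel_epic[OF q(2)]])
    show "q \<odot> (m \<odot> r) = Zero C B G"
      using cmp_assoc[OF r(1) m(1) q(1)] cokernel_cmp[OF q(2,1) m(1)]
        cmp_zero_left[OF r(1) hom_objs(2)[OF q(1)]] by simp
  next
    fix X x assume x: "x \<in> Hom C E X" "x \<odot> (m \<odot> r) = Zero C B X"
    have X: "X \<in> Obj C"
      using hom_objs(2)[OF x(1)] .
    have "x \<odot> m = Zero C Q X"
      by (rule epicD[OF cokernel_epic[OF r(2)] r(1) cmp_hom[OF m(1) x(1)]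
            zero_hom[OF hom_objs(1)[OF m(1)] X]])
        (use cmp_assoc[OF r(1) m(1) x(1)] x(2) cmp_zero_left[OF r(1) X] in simp)
    then show "\<exists>u \<in> Hom C G X. u \<odot> q = x"
      using cokernel_ex1[OF q(2,1) m(1) x(1)] by blast
  qed
  then have "exact_at C (m \<odot> r) q"
    using exact_atI monic_kernel_cokernel[OF m(2) q(2)] by blast
  ultimately show ?thesis
    using exact_at_monic[OF j] exact_at_epic[OF q(1) cokernel_epic[OF q(2)]]
    by (simp add: exact_sequence_iff homD[OF j(1)] homD[OF q(1)] nth_Cons less_Suc_eq
        split: nat.splits)
qed

text \<open>The third isomorphism theorem. As \<open>j2 \<odot> j1\<close> is a kernel of
  \<open>p1\<close> and \<open>j2\<close> is monic, \<open>j1\<close> is a kernel of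
  \<open>p1 \<odot> j2 = m \<odot> r\<close>, so \<open>m\<close> is the map out of the coimage and
  hence monic. If \<open>x\<close> kills \<open>m\<close>, then \<open>x \<odot> p1\<close> kills
  \<open>j2\<close> and factors through \<open>p2 = q \<odot> p1\<close>; cancelling the epic
  \<open>p1\<close> factors \<open>x\<close> through \<open>q\<close>.\<close>

lemma quotient_exact:
  assumes j1: "j1 \<in> Hom C F1 F2" "monic C j1" and j2: "j2 \<in> Hom C F2 G" "monic C j2"
    and p1: "p1 \<in> Hom C G GF1" "is_cokernel C p1 (j2 \<odot> j1)"
    and p2: "p2 \<in> Hom C G GF2" "is_cokernel C p2 j2"
    and r: "r \<in> Hom C F2 Q" "is_cokernel C r j1"
    and q: "q \<in> Hom C GF1 GF2" "q \<odot> p1 = p2"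
    and m: "m \<in> Hom C Q GF1" "m \<odot> r = p1 \<odot> j2"
  shows "monic C m" "is_cokernel C q m"
proof -
  have jj: "j2 \<odot> j1 \<in> Hom C F1 G" and f: "p1 \<odot> j2 \<in> Hom C F2 GF1"
    using cmp_hom[OF j1(1) j2(1)] cmp_hom[OF j2(1) p1(1)] .
  have ker: "is_kernel C (j2 \<odot> j1) p1"
    by (rule monic_kernel_cokernel[OF monic_cmp[OF j1(2,1) j2(2,1)] p1(2)])
  have "is_kernel C j1 (p1 \<odot> j2)"
  proof (rule is_kernelI[OF j1(1) f _ _ j1(2)])
    show "(p1 \<odot> j2) \<odot> j1 = Zero C F1 GF1"
      using cmp_assoc[OF j1(1) j2(1) p1(1)] kernel_cmp[OF ker jj p1(1)] by simp
  next
    fix X x assume x: "x \<in> Hom C X F2" "(p1 \<odot> j2) \<odot> x = Zero C X GF1"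
    have "p1 \<odot> (j2 \<odot> x) = Zero C X GF1"
      using cmp_assoc[OF x(1) j2(1) p1(1)] x(2) by simp
    then obtain z where z: "z \<in> Hom C X F1" "(j2 \<odot> j1) \<odot> z = j2 \<odot> x"
      using kernel_ex1[OF ker jj p1(1) cmp_hom[OF x(1) j2(1)]] by blast
    have "j1 \<odot> z = x"
      by (rule monicD[OF j2(2,1) cmp_hom[OF z(1) j1(1)] x(1)])
        (use cmp_assoc[OF z(1) j1(1) j2(1)] z(2) in simp)
    then show "\<exists>z \<in> Hom C X F1. j1 \<odot> z = x"
      using z(1) by blast
  qed
  then show "monic C m"
    using coimage_map_monic[OF _ r(2,1) m(1)] m(2) by simp
  show "is_cokernel C q m"
  proof (rule is_cokernelI[OF q(1) m(1)])
    have Q: "Q \<in> Obj C" and GF2: "GF2 \<in> Obj C"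
      using hom_objs(1)[OF m(1)] hom_objs(2)[OF q(1)] .
    show "q \<odot> m = Zero C Q GF2"
    proof (rule epicD[OF cokernel_epic[OF r(2)] r(1) cmp_hom[OF m(1) q(1)] zero_hom[OF Q GF2]])
      show "(q \<odot> m) \<odot> r = Zero C Q GF2 \<odot> r"
        using cmp_assoc[OF r(1) m(1) q(1)] m(2) cmp_assoc[OF j2(1) p1(1) q(1)] q(2)
          cokernel_cmp[OF p2(2,1) j2(1)] cmp_zero_left[OF r(1) GF2] by simp
    qed
    show "epic C q"
      using epic_second[OF p1(1) q(1)] q(2) cokernel_epic[OF p2(2)] by simp
  next
    fix X x assume x: "x \<in> Hom C GF1 X" "x \<odot> m = Zero C Q X"
    have X: "X \<in> Obj C"
      using hom_objs(2)[OF x(1)] .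
    have xp: "x \<odot> p1 \<in> Hom C G X"
      using cmp_hom[OF p1(1) x(1)] .
    have "(x \<odot> p1) \<odot> j2 = Zero C F2 X"
      using cmp_assoc[OF j2(1) p1(1) x(1)] m(2) cmp_assoc[OF r(1) m(1) x(1)] x(2)
        cmp_zero_left[OF r(1) X] by simp
    then obtain u where u: "u \<in> Hom C GF2 X" "u \<odot> p2 = x \<odot> p1"
      using cokernel_ex1[OF p2(2,1) j2(1) xp] by blast
    have "u \<odot> q = x"
      by (rule epicD[OF cokernel_epic[OF p1(2)] p1(1) cmp_hom[OF q(1) u(1)] x(1)])
        (use cmp_assoc[OF p1(1) q(1) u(1)] q(2) u(2) in simp)
    then show "\<exists>u \<in> Hom C GF2 X. u \<odot> q = x"
      using u(1) by blast
  qed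
qed

end

text \<open>Subobjects are monics and quotients arbitrary cokernels of them, so nothing depends on a
  choice of quotient. The arrows \<open>q\<close> and \<open>m\<close> are the induced ones: as
  \<open>p1\<close> and \<open>r\<close> are epic, their equations determine them.\<close>

theorem lemma1:
  fixes C :: "('o, 'm) precat" (structure)
    and F1 F2 G G_F1 G_F2 F2_F1 :: 'o
    and j1 j2 p1 p2 r f q m :: 'm
    and \<alpha> :: "('o, 'm) darr"
  assumes "abelian_category C"
    and "j1 \<in> Hom C F1 F2" and "monic C j1"
    and "j2 \<in> Hom C F2 G" and "monic C j2"
    and "p1 \<in> Hom C G G_F1" and "is_cokernel C p1 (j2 \<odot> j1)"
    and "p2 \<in> Hom C G G_F2" and "is_cokernel C p2 j2"
    and "r \<in> Hom C F2 F2_F1" and "is_cokernel C r j1"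
    and "f = p1 \<odot> j2"
    and "q \<in> Hom C G_F1 G_F2" and "q \<odot> p1 = p2"
    and "m \<in> Hom C F2_F1 G_F1" and "m \<odot> r = p1 \<odot> j2"
    and "\<alpha> = yoneda_class C [j1, f, q]"
  shows "exact_sequence C [j1, f, q] \<and> \<alpha> \<in> Ext C 2 G_F2 F1 \<and>
    (\<exists>\<alpha>1 \<in> Ext C 1 F2_F1 F1. \<exists>\<alpha>2 \<in> Ext C 1 G_F2 F2_F1.
       exact_sequence C [j1, r] \<and> \<alpha>1 = yoneda_class C [j1, r] \<and>
       exact_sequence C [m, q] \<and> \<alpha>2 = yoneda_class C [m, q] \<and>
       \<alpha> = yoneda_product C \<alpha>1 \<alpha>2)"
proof -
  interpret abelian_category C
    by fact
  note j1 = assms(2,3) and r = assms(10,11)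
  note q = assms(13) and m = assms(15)
  note mq = quotient_exact[OF assms(2-11,13-16)]
  \<comment> \<open>Factoring \<open>f\<close> through F2/F1 is what cuts the four-term sequence
    into the two short ones.\<close>
  have f: "f = m \<odot> r"
    using assms(12,16) by simp
  have ex: "exact_sequence C [j1, f, q]" "exact_sequence C [j1, r]" "exact_sequence C [m, q]"
    unfolding f
    by (rule exact_sequence_splice[OF j1 r m mq(1) q mq(2)] exact_sequence_short[OF j1 r]
        exact_sequence_short[OF m mq(1) q mq(2)])+
  have "yoneda_class C [j1, f, q] \<in> Ext C 2 G_F2 F1" "yoneda_class C [j1, r] \<in> Ext C 1 F2_F1 F1"
    "yoneda_class C [m, q] \<in> Ext C 1 G_F2 F2_F1"
    using yoneda_class_Ext[OF ex(1)] yoneda_class_Ext[OF ex(2)] yoneda_class_Ext[OF ex(3)]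
    by (simp_all add: homD[OF j1(1)] homD[OF r(1)] homD[OF m] homD[OF q] numeral_2_eq_2)
  moreover have "yoneda_class C [j1, f, q]
      = yoneda_product C (yoneda_class C [j1, r]) (yoneda_class C [m, q])"
    using yoneda_class_splice[OF ex(1)[unfolded f] ex(2,3) j1(1) r(1) m q] f by simp
  ultimately show ?thesis
    unfolding assms(17) using ex by blast
qed

end
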